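(* Let $(X,p)$ be a smooth analytic germ of dimension $d$ in $\mathbb{C}^n$ (with $p\in X$), with $d<n$. Let $L\subseteq \mathrm{Der}(-\log X)_p$ be an $\mathcal{O}_{\mathbb{C}^n,p}$-submodule, and let $L_0\subseteq L$ be the submodule of vector fields vanishing at $p$. Then the following are equivalent: (1) in $\mathcal{O}_{\mathbb{C}^n,p}$, $I_{d+1}(L)\nsubseteq \mathcal{M}_p^2$; (2) $\dim(\langle L\rangle_p)=d$ and the map $\alpha:L_0\to\mathrm{End}_{\mathbb{C}}(I(X)/\mathcal{M}_p\cdot I(X))$, $\alpha(\xi)=(f\mapsto\xi(f))$, is nonzero; (3) $\dim(\langle L\rangle_p)=d$ and the map $\beta:L_0\to\mathrm{End}_{\mathbb{C}}(T_p\mathbb{C}^n/\langle L\rangle_p)$, $\beta(\xi)=d(\widehat{\xi})_{(p)}$, is nonzero.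
   Context: $\mathcal{O}_{\mathbb{C}^n,p}$ is the ring of germs at $p$ of holomorphic functions, $\mathcal{M}_p$ its maximal ideal, and $\mathrm{Der}_{\mathbb{C}^n,p}$ the module of germs at $p$ of holomorphic vector fields. For an analytic germ $(X,p)$ (always reduced), $I(X)\subseteq\mathcal{O}_{\mathbb{C}^n,p}$ is the ideal of germs vanishing on $X$, and $\mathrm{Der}(-\log X)_p=\{\eta\in \mathrm{Der}_{\mathbb{C}^n,p}:\eta(I(X))\subseteq I(X)\}$. For a submodule $L\subseteq\mathrm{Der}_{\mathbb{C}^n,p}$ generated by $\eta_1,\ldots,\eta_m$, write $\eta_j=\sum_{i=1}^n a_{ij}\frac{\partial}{\partial z_i}$ in holomorphic coordinates; $I_k(L)$ ($1\le k\le n$) is the ideal generated by the $k\times k$ minors of the $n\times m$ matrix $(a_{ij})$ (independent of choices). Also $\langle L\rangle_p=\{\eta(p):\eta\in L\}\subseteq T_p\mathbb{C}^n$. If $\eta\in\mathrm{Der}_{\mathbb{C}^n,p}$ has $\eta(p)=0$, choose local coordinates $x_1,\ldots,x_n$ near $p$, write $\eta=\sum_i g_i\frac{\partial}{\partial x_i}$, and define the linear map $d(\widehat{\eta})_{(p)}:T_p\mathbb{C}^n\to T_p\mathbb{C}^n$ by $d(\widehat{\eta})_{(p)}(v)=\sum_{i} d(g_i)_{(p)}(v)\,\frac{\partial}{\partial x_i}(p)$, with $d(g_i)_{(p)}(v)\in\mathbb{C}$ the directional derivative; this is independent of the coordinates. $\alpha(\xi)$ is the endomorphism induced on the quotient by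 $f\mapsto\xi(f)$ on $I(X)$; $\beta(\xi)$ is the endomorphism of the quotient induced by $d(\widehat{\xi})_{(p)}$ (which, when $\dim\langle L\rangle_p=d$, maps $\langle L\rangle_p$ into itself). *)

theory Defs
  imports "HOL-Analysis.Analysis" "HOL-Library.Set_Algebras"
    "HOL-Algebra.Module" "HOL-Algebra.Ideal_Product"
begin

section \<open>Holomorphic functions of several variables\<close>

text \<open>
  The space \<open>\<complex>\<^sup>n\<close> is \<^typ>\<open>complex^'n\<close> with \<open>n = CARD('n)\<close>.  Since
  \<^const>\<open>has_derivative\<close> is only real-linear, complex linearity is imposed by the shape of
  the derivative.  The predicates below are meant for open \<open>U\<close>.
\<close>

definition holomorphic_fun_on :: "(complex^'n \<Rightarrow> complex) \<Rightarrow> (complex^'n) set \<Rightarrow> bool" where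
  "holomorphic_fun_on f U \<longleftrightarrow>
     (\<forall>z\<in>U. \<exists>A :: complex^'n. (f has_derivative (\<lambda>v. \<Sum>i\<in>UNIV. A $ i * v $ i)) (at z))"

definition holomorphic_map_on ::
    "(complex^'n \<Rightarrow> complex^'m) \<Rightarrow> (complex^'n) set \<Rightarrow> bool" where
  "holomorphic_map_on F U \<longleftrightarrow> (\<forall>i. holomorphic_fun_on (\<lambda>z. F z $ i) U)"

definition partial :: "'n \<Rightarrow> (complex^'n \<Rightarrow> complex) \<Rightarrow> complex^'n \<Rightarrow> complex" where
  "partial i f z = frechet_derivative f (at z) (axis i 1)"


section \<open>Germs\<close>

text \<open>A germ at \<open>p\<close> is an equivalence class of functions that agree near \<open>p\<close>.\<close>

type_synonym ('n, 'a) germ = "(complex^'n \<Rightarrow> 'a) set"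

definition germ :: "complex^'n \<Rightarrow> (complex^'n \<Rightarrow> 'a) \<Rightarrow> ('n, 'a) germ" where
  "germ p f = {g. \<forall>\<^sub>F z in nhds p. g z = f z}"

definition rep :: "('n, 'a) germ \<Rightarrow> complex^'n \<Rightarrow> 'a" where
  "rep a = (SOME f. f \<in> a)"

definition germ_val :: "complex^'n \<Rightarrow> ('n, 'a) germ \<Rightarrow> 'a" where
  "germ_val p a = rep a p"

definition germ_ring :: "complex^'n \<Rightarrow> ('n, complex) germ ring" where
  "germ_ring p =
     \<lparr> carrier = {germ p f | f. \<exists>U. open U \<and> p \<in> U \<and> holomorphic_fun_on f U},
       mult = (\<lambda>a b. germ p (\<lambda>z. rep a z * rep b z)),
       one = germ p (\<lambda>_. 1),
       zero = germ p (\<lambda>_. 0),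
       add = (\<lambda>a b. germ p (\<lambda>z. rep a z + rep b z)) \<rparr>"

definition max_ideal :: "complex^'n \<Rightarrow> ('n, complex) germ set" where
  "max_ideal p = {a \<in> carrier (germ_ring p). germ_val p a = 0}"


section \<open>Germs of holomorphic vector fields\<close>

text \<open>
  The vector field \<open>\<Sum>i. g\<^sub>i \<partial>/\<partial>z\<^sub>i\<close> is the map \<open>z \<mapsto> (g\<^sub>i z)\<^sub>i\<close>, and the tangent
  space at \<open>p\<close> is \<^typ>\<open>complex^'n\<close>.  The fields \<open>mult\<close> and \<open>one\<close> of the record are
  irrelevant for a module.
\<close>

definition der_module ::
    "complex^'n \<Rightarrow> (('n, complex) germ, ('n, complex^'n) germ) module" where
  "der_module p =
     \<lparr> carrier = {germ p F | F. \<exists>U. open U \<and> p \<in> U \<and> holomorphic_map_on F U},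
       mult = undefined,
       one = undefined,
       zero = germ p (\<lambda>_. 0),
       add = (\<lambda>\<xi> \<eta>. germ p (\<lambda>z. rep \<xi> z + rep \<eta> z)),
       smult = (\<lambda>a \<xi>. germ p (\<lambda>z. rep a z *s rep \<xi> z)) \<rparr>"

definition coefficient ::
    "complex^'n \<Rightarrow> ('n, complex^'n) germ \<Rightarrow> 'n \<Rightarrow> ('n, complex) germ" where
  "coefficient p \<xi> i = germ p (\<lambda>z. rep \<xi> z $ i)"

definition der_apply ::
    "complex^'n \<Rightarrow> ('n, complex^'n) germ \<Rightarrow> ('n, complex) germ \<Rightarrow> ('n, complex) germ" where
  "der_apply p \<xi> a = germ p (\<lambda>z. \<Sum>i\<in>UNIV. rep \<xi> z $ i * partial i (rep a) z)"

definition module_gen ::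
    "('a, 'c) ring_scheme \<Rightarrow> ('a, 'b, 'd) module_scheme \<Rightarrow> 'b set \<Rightarrow> 'b set" where
  "module_gen R M G = \<Inter>{H. submodule H R M \<and> G \<subseteq> H}"

definition eval_space :: "complex^'n \<Rightarrow> ('n, complex^'n) germ set \<Rightarrow> (complex^'n) set" where
  "eval_space p L = germ_val p ` L"

definition vanishing_fields ::
    "complex^'n \<Rightarrow> ('n, complex^'n) germ set \<Rightarrow> ('n, complex^'n) germ set" where
  "vanishing_fields p L = {\<xi> \<in> L. germ_val p \<xi> = 0}"

text \<open>The linear part at \<open>p\<close> of a vector field vanishing at \<open>p\<close>.\<close>

definition linear_part ::
    "complex^'n \<Rightarrow> ('n, complex^'n) germ \<Rightarrow> complex^'n \<Rightarrow> complex^'n" where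
  "linear_part p \<xi> v = (\<chi> i. frechet_derivative (\<lambda>z. rep \<xi> z $ i) (at p) v)"


section \<open>Ideals of minors\<close>

definition ring_det :: "('a, 'b) ring_scheme \<Rightarrow> nat \<Rightarrow> (nat \<Rightarrow> nat \<Rightarrow> 'a) \<Rightarrow> 'a" where
  "ring_det R k A =
     finsum R
       (\<lambda>\<pi>. (if evenperm \<pi> then \<one>\<^bsub>R\<^esub> else \<ominus>\<^bsub>R\<^esub> \<one>\<^bsub>R\<^esub>) \<otimes>\<^bsub>R\<^esub> finprod R (\<lambda>i. A i (\<pi> i)) {..<k})
       {\<pi>. \<pi> permutes {..<k}}"

text \<open>
  The columns of the matrix of coefficients are indexed by a set \<open>G\<close> of vector fields, its rows
  by \<^typ>\<open>'n\<close>.  A minor is given by \<open>k\<close> distinct rows and \<open>k\<close> distinct columns; as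
  \<open>'n\<close> and \<open>G\<close> carry no order, minors are determined up to sign, which does not affect the
  ideal.  \<open>G\<close> need not be finite, so that \<open>G\<close> may in particular be a whole submodule.
\<close>

definition minors ::
    "complex^'n \<Rightarrow> nat \<Rightarrow> ('n, complex^'n) germ set \<Rightarrow> ('n, complex) germ set" where
  "minors p k G =
     {ring_det (germ_ring p) k (\<lambda>i j. coefficient p (c j) (r i)) | r c.
        inj_on r {..<k} \<and> inj_on c {..<k} \<and> c ` {..<k} \<subseteq> G}"

definition minor_ideal ::
    "complex^'n \<Rightarrow> nat \<Rightarrow> ('n, complex^'n) germ set \<Rightarrow> ('n, complex) germ set" where
  "minor_ideal p k G = Idl\<^bsub>germ_ring p\<^esub> (minors p k G)"


section \<open>Analytic germs\<close>

text \<open>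
  A subset \<open>X\<close> of \<open>\<complex>\<^sup>n\<close> stands for its germ at \<open>p\<close>.  The germ is smooth of dimension
  \<open>d\<close> if \<open>X\<close> is near \<open>p\<close> a complex submanifold of dimension \<open>d\<close>: a biholomorphic
  chart \<open>\<phi>\<close> with inverse \<open>\<psi>\<close> maps it onto an open subset of a coordinate subspace, whose free
  coordinates are those in \<open>S\<close>.
\<close>

definition smooth_germ :: "(complex^'n) set \<Rightarrow> complex^'n \<Rightarrow> nat \<Rightarrow> bool" where
  "smooth_germ X p d \<longleftrightarrow> p \<in> X \<and>
     (\<exists>U V \<phi> \<psi> (S :: 'n set).
        open U \<and> open V \<and> p \<in> U \<and> homeomorphism U V \<phi> \<psi> \<and>
        holomorphic_map_on \<phi> U \<and> holomorphic_map_on \<psi> V \<and>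
        card S = d \<and> \<phi> ` (X \<inter> U) = {w \<in> V. \<forall>i. i \<notin> S \<longrightarrow> w $ i = 0})"

definition vanishing_ideal ::
    "complex^'n \<Rightarrow> (complex^'n) set \<Rightarrow> ('n, complex) germ set" where
  "vanishing_ideal p X = {a \<in> carrier (germ_ring p). \<forall>\<^sub>F z in nhds p. z \<in> X \<longrightarrow> rep a z = 0}"

definition der_log :: "complex^'n \<Rightarrow> (complex^'n) set \<Rightarrow> ('n, complex^'n) germ set" where
  "der_log p X = {\<eta> \<in> carrier (der_module p).
     \<forall>a \<in> vanishing_ideal p X. der_apply p \<eta> a \<in> vanishing_ideal p X}"


section \<open>The induced endomorphisms\<close>

text \<open>
  Elements of the quotients are cosets.  The map induced by \<open>h\<close> sends a coset \<open>C\<close> to the unique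
  coset that contains \<open>h x\<close> for all \<open>x \<in> C\<close>.
\<close>

definition MI :: "complex^'n \<Rightarrow> (complex^'n) set \<Rightarrow> ('n, complex) germ set" where
  "MI p X = max_ideal p \<cdot>\<^bsub>germ_ring p\<^esub> vanishing_ideal p X"

definition conormal :: "complex^'n \<Rightarrow> (complex^'n) set \<Rightarrow> ('n, complex) germ set set" where
  "conormal p X = carrier ((germ_ring p)\<lparr>carrier := vanishing_ideal p X\<rparr> A_Mod MI p X)"

definition alpha :: "complex^'n \<Rightarrow> (complex^'n) set \<Rightarrow> ('n, complex^'n) germ \<Rightarrow>
    ('n, complex) germ set \<Rightarrow> ('n, complex) germ set" where
  "alpha p X \<xi> =
     (\<lambda>C \<in> conormal p X. the_elem ((\<lambda>a. MI p X +>\<^bsub>germ_ring p\<^esub> der_apply p \<xi> a) ` C))"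

definition zero_conormal :: "complex^'n \<Rightarrow> (complex^'n) set \<Rightarrow>
    ('n, complex) germ set \<Rightarrow> ('n, complex) germ set" where
  "zero_conormal p X = (\<lambda>C \<in> conormal p X. MI p X)"

definition normal_space :: "complex^'n \<Rightarrow> ('n, complex^'n) germ set \<Rightarrow> (complex^'n) set set" where
  "normal_space p L = range (\<lambda>v. v +o eval_space p L)"

definition beta :: "complex^'n \<Rightarrow> ('n, complex^'n) germ set \<Rightarrow> ('n, complex^'n) germ \<Rightarrow>
    (complex^'n) set \<Rightarrow> (complex^'n) set" where
  "beta p L \<xi> =
     (\<lambda>C \<in> normal_space p L. the_elem ((\<lambda>v. linear_part p \<xi> v +o eval_space p L) ` C))"

definition zero_normal :: "complex^'n \<Rightarrow> ('n, complex^'n) germ set \<Rightarrow>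
    (complex^'n) set \<Rightarrow> (complex^'n) set" where
  "zero_normal p L = (\<lambda>C \<in> normal_space p L. eval_space p L)"

end

theory Submission
  imports Defs "HOL-Complex_Analysis.Cauchy_Integral_Formula" "Jordan_Normal_Form.Determinant"
begin

text \<open>
  Let \<open>W = \<langle>L\<rangle>\<^sub>p\<close>, let \<open>I\<close> be the ideal of \<open>X\<close>, \<open>M\<close> the maximal ideal, and let
  \<open>T\<close> be the common kernel of the differentials at \<open>p\<close> of the elements of \<open>I\<close>, which is the
  tangent space of \<open>X\<close>.  A field in \<open>L\<close> maps \<open>I\<close> into \<open>I\<close>, hence \<open>W \<subseteq> T\<close>; as
  \<open>dim T \<le> d\<close> by a chart of \<open>X\<close>, the condition \<open>dim W = d\<close> forces \<open>W = T\<close>.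

  The analytic input is that first order data detect membership in \<open>M I\<close>: an element of \<open>I\<close>
  lies in \<open>M I\<close> iff its differential at \<open>p\<close> vanishes (\<open>MI_iff_grad_zero\<close>).  In a chart
  that maps \<open>X\<close> to a coordinate subspace, Hadamard's lemma writes \<open>f \<in> I\<close> as
  \<open>\<Sum> w\<^sub>j h\<^sub>j\<close>, the sum running over the coordinates that vanish on \<open>X\<close>, with
  \<open>h\<^sub>j(p) = \<partial>f/\<partial>w\<^sub>j\<close> at \<open>p\<close>; the differential of \<open>f\<close> vanishes iff all \<open>h\<^sub>j\<close> lie
  in \<open>M\<close>.  Applied to the point \<open>X = {p}\<close> this also describes \<open>M\<^sup>2\<close>.  Hadamard's lemma
  for holomorphic functions rests on the holomorphy of partial derivatives, which comes from
  differentiating Cauchy's integral for \<open>\<partial>f/\<partial>z\<^sub>i\<close> under the integral sign.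

  For \<open>\<xi>\<close> vanishing at \<open>p\<close> the differential of \<open>\<xi>(f)\<close> at \<open>p\<close> is that of \<open>f\<close> composed
  with the linear part of \<open>\<xi>\<close>.  So, if \<open>W = T\<close>, both \<open>\<alpha>(\<xi>) = 0\<close> and \<open>\<beta>(\<xi>) = 0\<close> say
  that the linear part of \<open>\<xi>\<close> has its image in \<open>T\<close>; this is the equivalence of
  \<open>condition2\<close> and \<open>condition3\<close>.

  For \<open>condition1\<close> and \<open>condition3\<close> consider the minor \<open>m\<close> of fields \<open>\<eta>\<^sub>0,\<dots>,\<eta>\<^sub>d\<close> in \<open>L\<close>.  Their values lie in
  \<open>W\<close>, so \<open>\<xi> = \<Sum> x\<^sub>j \<eta>\<^sub>j\<close> vanishes at \<open>p\<close> for some constants \<open>x\<^sub>j\<close> with, say,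
  \<open>x\<^sub>k \<noteq> 0\<close>.  By Cramer's rule \<open>x\<^sub>k m\<close> is the minor with \<open>\<eta>\<^sub>k\<close> replaced by \<open>\<xi>\<close>, and
  as \<open>\<xi>(p) = 0\<close> its derivative at \<open>p\<close> in direction \<open>v\<close> is the determinant with that column
  replaced by the linear part of \<open>\<xi>\<close> at \<open>v\<close>.  If \<open>m \<notin> M\<^sup>2\<close>, some such determinant is nonzero:
  the remaining \<open>d\<close> values are a basis of \<open>W\<close>, and the linear part of \<open>\<xi>\<close> leaves \<open>W\<close>
  (\<open>normal_direction_of_minor\<close>).  Conversely, complete a basis of \<open>W\<close> of values of
  generators by such a \<open>\<xi>\<close> and choose rows for which the determinant is nonzero.  The fields whose
  minor with the chosen generators lies in \<open>M\<^sup>2\<close> form a submodule, which misses \<open>\<xi>\<close>;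
  hence it misses a generator (\<open>minor_of_normal_direction\<close>).
\<close>

section \<open>Complex gradients and parameter integrals\<close>

(* Here the dollar sign selects components of vectors in C^n, and vec_eq_iff is the extensionality of
   these vectors. *)
no_notation Matrix.vec_index (infixl \<open>$\<close> 100)
hide_fact (open) Matrix.vec_eq_iff

definition linform :: "complex^'n \<Rightarrow> complex^'n \<Rightarrow> complex" where
  "linform A v = (\<Sum>i\<in>UNIV. A $ i * v $ i)"

definition grad :: "(complex^'n \<Rightarrow> complex) \<Rightarrow> complex^'n \<Rightarrow> complex^'n" where
  "grad f z = (\<chi> i. partial i f z)"

lemma linform_axis [simp]: "linform A (axis i 1) = A $ i"
  unfolding linform_def axis_def by (simp add: if_distrib cong: if_cong)

lemma linform_axis_left: "linform (axis k 1) v = v $ k"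
  by (simp add: linform_def axis_def if_distrib if_distribR cong: if_cong)

lemma linform_add: "linform A (v + w) = linform A v + linform A w"
  by (simp add: linform_def distrib_left sum.distrib)

lemma linform_scale: "linform A (c *s v) = c * linform A v"
  by (simp add: linform_def sum_distrib_left mult_ac)

lemma bounded_linear_linform: "bounded_linear (linform A)"
  unfolding linform_def
  by (intro bounded_linear_sum bounded_linear_const_mult bounded_linear_vec_nth)

lemma has_derivative_linform_unique:
  assumes "(f has_derivative linform A) (at z)"
  shows "frechet_derivative f (at z) = linform A" "grad f z = A"
proof -
  show 1: "frechet_derivative f (at z) = linform A"
    using frechet_derivative_at[OF assms] by simp
  show "grad f z = A"
    by (simp add: grad_def partial_def 1 vec_eq_iff)
qed

lemma holomorphic_fun_on_iff_grad:
  "holomorphic_fun_on f U \<longleftrightarrow> (\<forall>z\<in>U. (f has_derivative linform (grad f z)) (at z))"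
  unfolding holomorphic_fun_on_def linform_def[symmetric, abs_def]
  using has_derivative_linform_unique(2) by metis

lemma holomorphic_fun_onI:
  assumes "\<And>z. z \<in> U \<Longrightarrow> (f has_derivative linform (A z)) (at z)"
  shows "holomorphic_fun_on f U"
  unfolding holomorphic_fun_on_def linform_def[symmetric, abs_def] using assms by blast

lemma holomorphic_fun_on_imp_continuous_on:
  "holomorphic_fun_on f U \<Longrightarrow> continuous_on U f"
  unfolding holomorphic_fun_on_iff_grad
  by (meson continuous_at_imp_continuous_on has_derivative_continuous)

lemma holomorphic_fun_on_subset: "holomorphic_fun_on f U \<Longrightarrow> V \<subseteq> U \<Longrightarrow> holomorphic_fun_on f V"
  unfolding holomorphic_fun_on_def by blast

text \<open>
  The coefficients of the derivative are continuous in both variables, so Leibniz's rule allows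
  differentiation under the integral; complex linearity survives because the coefficients can be
  integrated separately.
\<close>

lemma holomorphic_fun_on_integral:
  fixes F :: "complex^'n \<Rightarrow> real \<Rightarrow> complex"
  assumes U: "open U" "convex U"
    and der: "\<And>z t. z \<in> U \<Longrightarrow> t \<in> {0..1} \<Longrightarrow> ((\<lambda>z. F z t) has_derivative linform (A z t)) (at z)"
    and contF: "\<And>z. z \<in> U \<Longrightarrow> continuous_on {0..1} (F z)"
    and contA: "continuous_on (U \<times> {0..1}) (\<lambda>(z, t). A z t)"
  shows "holomorphic_fun_on (\<lambda>z. integral {0..1} (F z)) U"
proof (rule holomorphic_fun_onI)
  fix z0 assume z0: "z0 \<in> U"
  \<comment> \<open>Leibniz's rule wants the derivative as a continuous map into bounded linear maps.\<close>
  define P :: "'n \<Rightarrow> (complex^'n) \<Rightarrow>\<^sub>L complex" where "P k = Blinfun (\<lambda>v. v $ k)" for k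
  have P: "blinfun_apply (P k) v = v $ k" for k v
    unfolding P_def by (simp add: bounded_linear_Blinfun_apply bounded_linear_vec_nth)
  define B where "B z t = (\<Sum>k\<in>UNIV. blinfun_mult_right (A z t $ k) o\<^sub>L P k)" for z t
  have B: "blinfun_apply (B z t) = linform (A z t)" for z t
    by (rule ext) (simp add: B_def linform_def blinfun.sum_left P)
  have contA': "continuous_on (U \<times> {0..1}) (\<lambda>x. A (fst x) (snd x) $ k)" for k
    using contA by (intro continuous_intros) (simp add: case_prod_unfold)
  have contB: "continuous_on (U \<times> cbox 0 1) (\<lambda>(z, t). B z t)"
    unfolding B_def case_prod_unfold box_real
    by (intro continuous_intros contA' bounded_linear.continuous_on[OF bounded_linear_blinfun_mult_right])
  have "((\<lambda>z. integral (cbox 0 1) (F z)) has_derivative integral (cbox 0 1) (B z0)) (at z0 within U)"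
  proof (rule leibniz_rule[OF _ _ contB z0 U(2)])
    show "((\<lambda>z. F z t) has_derivative blinfun_apply (B z t)) (at z within U)"
      if "z \<in> U" "t \<in> cbox 0 1" for z t
      using der[of z t] that by (auto simp: B intro: has_derivative_at_withinI)
    show "F z integrable_on cbox 0 1" if "z \<in> U" for z
      using contF[OF that] by (intro integrable_continuous) simp
  qed
  then have 1: "((\<lambda>z. integral {0..1} (F z)) has_derivative integral {0..1} (B z0)) (at z0)"
    by (simp add: at_within_open[OF z0 U(1)])
  have contB0: "continuous_on {0..1} (B z0)"
  proof -
    have "continuous_on {0..1} ((\<lambda>(z, t). B z t) \<circ> (\<lambda>t. (z0, t)))"
      by (rule continuous_on_compose, intro continuous_intros, rule continuous_on_subset[OF contB])
        (use z0 in auto)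
    then show ?thesis by (simp add: o_def)
  qed
  have "blinfun_apply (integral {0..1} (B z0)) = linform (\<chi> k. integral {0..1} (\<lambda>t. A z0 t $ k))"
  proof
    fix v
    have contA0: "continuous_on {0..1} (\<lambda>t. A z0 t $ k)" for k
    proof -
      have "continuous_on {0..1} ((\<lambda>x. A (fst x) (snd x) $ k) \<circ> (\<lambda>t. (z0, t)))"
        by (rule continuous_on_compose, intro continuous_intros, rule continuous_on_subset[OF contA'])
          (use z0 in auto)
      then show ?thesis by (simp add: o_def)
    qed
    have "blinfun_apply (integral {0..1} (B z0)) v = integral {0..1} ((\<lambda>b. blinfun_apply b v) \<circ> B z0)"
      by (rule integral_linear[symmetric])
        (auto intro!: integrable_continuous_interval contB0 bounded_linear_intros)
    also have "\<dots> = integral {0..1} (\<lambda>t. \<Sum>k\<in>UNIV. A z0 t $ k * v $ k)"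
      by (simp add: o_def B linform_def)
    also have "\<dots> = (\<Sum>k\<in>UNIV. integral {0..1} (\<lambda>t. A z0 t $ k * v $ k))"
      by (intro integral_sum integrable_continuous_interval continuous_intros contA0) auto
    also have "\<dots> = linform (\<chi> k. integral {0..1} (\<lambda>t. A z0 t $ k)) v"
      by (simp add: linform_def)
    finally show "blinfun_apply (integral {0..1} (B z0)) v =
      linform (\<chi> k. integral {0..1} (\<lambda>t. A z0 t $ k)) v" .
  qed
  with 1 show "((\<lambda>z. integral {0..1} (F z)) has_derivative
      linform (\<chi> k. integral {0..1} (\<lambda>t. A z0 t $ k))) (at z0)"
    by simp
qed

lemma has_derivative_linform_cmult:
  assumes "(f has_derivative linform A) F"
  shows "((\<lambda>z. f z * c) has_derivative linform (c *s A)) F"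
proof -
  have "linform (c *s A) = (\<lambda>v. linform A v * c)"
    by (rule ext) (simp add: linform_def sum_distrib_left sum_distrib_right mult_ac)
  then show ?thesis
    using has_derivative_mult_left[OF assms, of c] by simp
qed

lemma norm_axis_complex: "norm (axis i x :: complex^'n) = norm x"
proof -
  have "(norm ((axis i x :: complex^'n) $ j))\<^sup>2 = (if j = i then (norm x)\<^sup>2 else 0)" for j
    by (simp add: axis_def)
  then show ?thesis by (simp add: norm_vec_def L2_set_def)
qed

text \<open>
  Cauchy's formula for the first derivative of \<open>\<zeta> \<mapsto> f(z + \<zeta> e\<^sub>i)\<close> at \<open>0\<close>.  The circle is
  centred at the point itself, so the kernel \<open>1/\<zeta>\<^sup>2\<close> does not depend on \<open>z\<close>, and regularity in
  \<open>z\<close> of the integral only concerns \<open>f\<close>.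
\<close>

lemma partial_eq_integral:
  fixes f :: "complex^'n \<Rightarrow> complex"
  assumes f: "holomorphic_fun_on f U" and r: "0 < r" and U: "cball z r \<subseteq> U"
  shows "partial i f z =
    integral {0..1} (\<lambda>t. f (z + (r * cis (2 * pi * t)) *s axis i 1) * inverse (r * cis (2 * pi * t)))"
proof -
  define g where "g \<zeta> = f (z + \<zeta> *s axis i 1)" for \<zeta>
  have scale: "x *s axis i 1 = (axis i x :: complex^'n)" for x
    by (simp add: vec_eq_iff axis_def)
  have inU: "z + \<zeta> *s axis i 1 \<in> U" if "\<zeta> \<in> cball 0 r" for \<zeta>
  proof -
    have "norm (\<zeta> *s (axis i 1 :: complex^'n)) = norm \<zeta>"
      by (simp only: scale norm_axis_complex)
    then show ?thesis using that U by (auto simp: dist_norm)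
  qed
  have ax: "((\<lambda>\<zeta>. z + \<zeta> *s axis i 1) has_derivative (\<lambda>x. x *s axis i 1)) (at \<zeta>)" for \<zeta>
  proof -
    have "bounded_linear (\<lambda>x::complex. x *s (axis i 1 :: complex^'n))"
    proof (rule bounded_linear_intro)
      show "norm (x *s (axis i 1 :: complex^'n)) \<le> norm x * 1" for x :: complex
        by (simp only: scale norm_axis_complex)
    qed (auto simp: vec_eq_iff axis_def)
    from bounded_linear.has_derivative[OF this has_derivative_ident]
    show ?thesis by (auto intro!: derivative_eq_intros)
  qed
  have dg: "(g has_field_derivative partial i f (z + \<zeta> *s axis i 1)) (at \<zeta>)" if "\<zeta> \<in> cball 0 r" for \<zeta>
  proof -
    have "(f has_derivative linform (grad f (z + \<zeta> *s axis i 1))) (at (z + \<zeta> *s axis i 1))"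
      using f inU[OF that] by (auto simp: holomorphic_fun_on_iff_grad)
    from has_derivative_compose[OF ax this]
    show ?thesis
      by (simp add: has_field_derivative_def g_def[abs_def] linform_scale grad_def mult.commute[of _ "partial _ _ _"])
  qed
  have contg: "continuous_on (cball 0 r) g"
    by (meson DERIV_isCont continuous_at_imp_continuous_on dg)
  have holg: "g holomorphic_on ball 0 r"
    unfolding holomorphic_on_def field_differentiable_def
    by (meson ball_subset_cball dg has_field_derivative_at_within subsetD)
  have "(2 * pi * \<i>) * deriv g 0 = contour_integral (circlepath 0 r) (\<lambda>u. g u / (u - 0)^2)"
    using Cauchy_contour_integral_circlepath_2[OF contg holg, of 0] r by simp
  also have "\<dots> = integral {0..1} (\<lambda>t. g (circlepath 0 r t) / (circlepath 0 r t)^2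
      * vector_derivative (circlepath 0 r) (at t))"
    by (simp add: contour_integral_integral)
  also have "\<dots> = integral {0..1} (\<lambda>t. (2 * pi * \<i>) * (g (r * cis (2 * pi * t)) * inverse (r * cis (2 * pi * t))))"
  proof (rule integral_cong)
    fix t :: real assume t: "t \<in> {0..1}"
    define e where "e = r * cis (2 * pi * t)"
    have e: "circlepath 0 r t = e" "vector_derivative (circlepath 0 r) (at t) = 2 * pi * \<i> * e"
      unfolding vector_derivative_circlepath by (simp_all add: circlepath e_def cis_conv_exp mult_ac)
    have "e \<noteq> 0" using r by (simp add: e_def)
    then show "g (circlepath 0 r t) / (circlepath 0 r t)^2
      * vector_derivative (circlepath 0 r) (at t) = (2 * pi * \<i>) * (g (r * cis (2 * pi * t)) * inverse (r * cis (2 * pi * t)))"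
      unfolding e e_def[symmetric] by (simp add: power2_eq_square field_simps)
  qed
  also have "\<dots> = (2 * pi * \<i>) * integral {0..1} (\<lambda>t. g (r * cis (2 * pi * t)) * inverse (r * cis (2 * pi * t)))"
    by (rule integral_mult_right)
  finally have "deriv g 0 = integral {0..1} (\<lambda>t. g (r * cis (2 * pi * t)) * inverse (r * cis (2 * pi * t)))"
    by (simp only: mult_cancel_left) simp
  moreover have "deriv g 0 = partial i f z"
    using DERIV_imp_deriv[OF dg[of 0]] r by simp
  ultimately show ?thesis by (simp add: g_def)
qed

section \<open>Partial derivatives and Hadamard's lemma\<close>

lemma has_derivative_vec_componentwise:
  fixes T :: "'a::real_normed_vector \<Rightarrow> complex^'m"
  assumes "\<And>k. ((\<lambda>z. T z $ k) has_derivative (\<lambda>v. D v $ k)) (at z within S)"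
  shows "(T has_derivative D) (at z within S)"
  unfolding has_derivative_componentwise_within[of T]
proof
  fix b :: "complex^'m" assume "b \<in> Basis"
  then obtain k u where b: "b = axis k u" by (auto simp: Basis_vec_def)
  show "((\<lambda>x. T x \<bullet> b) has_derivative (\<lambda>x. D x \<bullet> b)) (at z within S)"
    unfolding b inner_axis by (intro has_derivative_inner_left assms)
qed

lemma vec_nth_has_derivative_linform:
  "((\<lambda>z. z $ k) has_derivative linform (axis k 1)) (at (z::complex^'n))"
proof -
  have "linform (axis k 1) = (\<lambda>v :: complex^'n. v $ k)"
    by (rule ext) (simp add: linform_def axis_def if_distrib if_distribR cong: if_cong)
  then show ?thesis
    using bounded_linear.has_derivative[OF bounded_linear_vec_nth has_derivative_ident, of k "at z"] by simp
qed

text \<open>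
  Provides one radius for Cauchy's formula at all points near \<open>z0\<close>.
\<close>

lemma open_uniform_cballE:
  fixes U :: "'a::metric_space set"
  assumes "open U" "z0 \<in> U"
  obtains r where "0 < r" "\<And>z. z \<in> ball z0 r \<Longrightarrow> cball z r \<subseteq> U"
proof -
  obtain R where R: "0 < R" "ball z0 R \<subseteq> U" using assms by (meson openE)
  have "cball z (R / 3) \<subseteq> U" if "z \<in> ball z0 (R / 3)" for z
  proof
    fix w assume "w \<in> cball z (R / 3)"
    with that have "dist z0 w < R" using dist_triangle[of z0 w z] R(1) by auto
    then show "w \<in> U" using R by auto
  qed
  then show ?thesis using R(1) that[of "R / 3"] by simp
qed

text \<open>
  Complex differentiability at every point already gives \<open>C\<^sup>1\<close>: in Cauchy's formula the
  derivative is an integral of values of \<open>f\<close>, which depend continuously on the point.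
\<close>

lemma grad_continuous_on:
  assumes f: "holomorphic_fun_on f U" and U: "open U"
  shows "continuous_on U (grad f)"
proof (rule continuous_at_imp_continuous_on, rule ballI)
  fix z0 assume "z0 \<in> U"
  then obtain r where r: "0 < r" and sub: "\<And>z. z \<in> ball z0 r \<Longrightarrow> cball z r \<subseteq> U"
    using open_uniform_cballE[OF U] by metis
  have inU: "z + (r * cis (2 * pi * t)) *s axis i 1 \<in> U" if "z \<in> ball z0 r" for z t i
  proof -
    have "(r * cis (2 * pi * t)) *s axis i 1 = (axis i (r * cis (2 * pi * t)) :: complex^'a)"
      by (simp add: vec_eq_iff axis_def)
    then have "norm ((r * cis (2 * pi * t)) *s axis i 1 :: complex^'a) = r"
      using r by (simp add: norm_axis_complex norm_mult)
    then show ?thesis using sub[OF that] by (auto simp: dist_norm)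
  qed
  have "continuous_on (ball z0 r) (\<lambda>z. partial i f z)" for i
  proof -
    have "continuous_on (ball z0 r) (\<lambda>z. integral (cbox 0 1)
       (\<lambda>t. f (z + (r * cis (2 * pi * t)) *s axis i 1) * inverse (r * cis (2 * pi * t))))"
    proof (rule integral_continuous_on_param)
      have "continuous_on (ball z0 r \<times> cbox 0 1)
         (f \<circ> (\<lambda>x. fst x + (r * cis (2 * pi * snd x)) *s axis i 1))"
        by (intro continuous_on_compose continuous_intros
              continuous_on_subset[OF holomorphic_fun_on_imp_continuous_on[OF f]])
          (use inU in \<open>auto simp: vector_scalar_mult_def intro!: continuous_intros\<close>)
      then show "continuous_on (ball z0 r \<times> cbox 0 1) (\<lambda>(z, t). f (z + (r * cis (2 * pi * t)) *s axis i 1)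
          * inverse (r * cis (2 * pi * t)))"
        unfolding case_prod_unfold o_def
        by (intro continuous_intros) (use r in auto)
    qed
    then show ?thesis
      using partial_eq_integral[OF f r sub] by (subst continuous_on_cong[OF refl]) auto
  qed
  then have "continuous_on (ball z0 r) (grad f)"
    unfolding grad_def[abs_def] by (intro continuous_intros)
  then show "isCont (grad f) z0"
    using r by (simp add: continuous_on_eq_continuous_at)
qed

text \<open>
  With the gradient known to be continuous, Cauchy's formula can be differentiated under the
  integral sign.
\<close>

lemma partial_holomorphic:
  assumes f: "holomorphic_fun_on f U" and U: "open U"
  shows "holomorphic_fun_on (partial i f) U"
proof (rule holomorphic_fun_onI)
  fix z0 assume "z0 \<in> U"
  then obtain r where r: "0 < r" and sub: "\<And>z. z \<in> ball z0 r \<Longrightarrow> cball z r \<subseteq> U"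
    using open_uniform_cballE[OF U] by metis
  define s where "s t = (axis i (r * cis (2 * pi * t)) :: complex^'a)" for t
  have s: "(r * cis (2 * pi * t)) *s axis i 1 = s t" for t
    by (simp add: vec_eq_iff axis_def s_def)
  have inU: "z + s t \<in> U" if "z \<in> ball z0 r" for z t
  proof -
    have "norm (s t) = r"
      using r by (simp add: norm_axis_complex norm_mult s_def)
    then show ?thesis using sub[OF that] by (auto simp: dist_norm)
  qed
  have conts: "continuous_on UNIV s"
    unfolding s[symmetric] by (auto simp: vector_scalar_mult_def intro!: continuous_intros)
  define c where "c t = inverse (r * cis (2 * pi * t))" for t
  have contc: "continuous_on UNIV c"
    unfolding c_def by (intro continuous_intros) (use r in auto)
  have 1: "holomorphic_fun_on (\<lambda>z. integral {0..1} (\<lambda>t. f (z + s t) * c t)) (ball z0 r)"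
  proof (rule holomorphic_fun_on_integral)
    fix z and t :: real assume z: "z \<in> ball z0 r"
    have "(f has_derivative linform (grad f (z + s t))) (at (z + s t))"
      using inU[OF z] f by (auto simp: holomorphic_fun_on_iff_grad)
    moreover have "((\<lambda>z. z + s t) has_derivative (\<lambda>v. v)) (at z)"
      by (auto intro!: derivative_eq_intros)
    ultimately have "((\<lambda>z. f (z + s t)) has_derivative linform (grad f (z + s t))) (at z)"
      by (rule has_derivative_compose[rotated])
    then show "((\<lambda>z. f (z + s t) * c t) has_derivative linform (c t *s grad f (z + s t))) (at z)"
      by (rule has_derivative_linform_cmult)
  next
    fix z assume z: "z \<in> ball z0 r"
    have "continuous_on {0..1} (f \<circ> (\<lambda>t. z + s t))"
      by (intro continuous_on_compose continuous_intros continuous_on_subset[OF conts]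
              continuous_on_subset[OF holomorphic_fun_on_imp_continuous_on[OF f]])
          (use inU z in auto)
    then show "continuous_on {0..1} (\<lambda>t. f (z + s t) * c t)"
      unfolding o_def by (intro continuous_intros continuous_on_subset[OF contc]) auto
  next
    have "continuous_on (ball z0 r \<times> {0..1}) (grad f \<circ> (\<lambda>x. fst x + s (snd x)))"
      by (intro continuous_on_compose continuous_intros continuous_on_compose2[OF conts]
              continuous_on_subset[OF grad_continuous_on[OF f U]])
          (use inU in auto)
    then show "continuous_on (ball z0 r \<times> {0..1}) (\<lambda>(z, t). c t *s grad f (z + s t))"
      unfolding case_prod_unfold o_def vector_scalar_mult_def
      by (intro continuous_intros continuous_on_compose2[OF contc]) auto
  qed auto
  have "(partial i f has_derivative linform (grad (\<lambda>z. integral {0..1} (\<lambda>t. f (z + s t) * c t)) z0)) (at z0)"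
  proof (rule has_derivative_transform_within_open)
    show "((\<lambda>z. integral {0..1} (\<lambda>t. f (z + s t) * c t)) has_derivative
        linform (grad (\<lambda>z. integral {0..1} (\<lambda>t. f (z + s t) * c t)) z0)) (at z0)"
      using 1 r by (simp add: holomorphic_fun_on_iff_grad)
    show "integral {0..1} (\<lambda>t. f (z + s t) * c t) = partial i f z" if "z \<in> ball z0 r" for z
      using partial_eq_integral[OF f r sub[OF that], of i] by (simp add: s c_def)
  qed (use r in auto)
  then show "(partial i f has_derivative linform (grad (partial i f) z0)) (at z0)"
    by (simp only: has_derivative_linform_unique(2)[of "partial i f"])
qed

text \<open>
  Let \<open>\<pi>\<close> be the projection onto the coordinate subspace.  Integrating the derivative of \<open>f\<close>
  along the segment from \<open>\<pi>(w)\<close>, where \<open>f\<close> vanishes, to \<open>w\<close> gives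
  \<open>h\<^sub>j(w) = \<integral> \<partial>f/\<partial>w\<^sub>j(\<pi>(w) + t (w - \<pi>(w))) dt\<close>.
\<close>

lemma hadamard_coordinate_subspace:
  fixes f :: "complex^'n \<Rightarrow> complex"
  assumes f: "holomorphic_fun_on f (ball w0 r)" and r: "0 < r"
    and w0: "\<And>j. j \<notin> S \<Longrightarrow> w0 $ j = 0"
    and van: "\<And>w. w \<in> ball w0 r \<Longrightarrow> (\<And>j. j \<notin> S \<Longrightarrow> w $ j = 0) \<Longrightarrow> f w = 0"
  obtains h where "\<And>j. holomorphic_fun_on (h j) (ball w0 r)"
    "\<And>j. h j w0 = partial j f w0"
    "\<And>w. w \<in> ball w0 r \<Longrightarrow> f w = (\<Sum>j\<in>-S. w $ j * h j w)"
proof -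
  \<comment> \<open>The segment: it runs from the projection of \<open>w\<close> at \<open>t = 0\<close> to \<open>w\<close> at \<open>t = 1\<close>, linearly in \<open>w\<close>.\<close>
  define T where "T w t = (\<chi> j. if j \<in> S then w $ j else of_real t * w $ j)" for w :: "complex^'n" and t :: real
  have T_ball: "T w t \<in> ball w0 r" if "w \<in> ball w0 r" "t \<in> {0..1}" for w t
  proof -
    \<comment> \<open>The centre lies in the coordinate subspace, so the segment does not leave the ball.\<close>
    have "norm (T w t - w0) \<le> norm (w - w0)"
      by (rule norm_le_componentwise_cart)
        (use that w0 in \<open>auto simp: T_def norm_mult mult_left_le_one_le\<close>)
    then show ?thesis using that by (simp add: dist_norm norm_minus_commute)
  qed
  have contT: "continuous_on A (\<lambda>x. T (fst x) (snd x))" for A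
    unfolding T_def
  proof (intro continuous_intros)
    fix j show "continuous_on A (\<lambda>x. if j \<in> S then fst x $ j else of_real (snd x) * fst x $ j)"
      by (cases "j \<in> S") (auto intro!: continuous_intros)
  qed
  have contT0: "continuous_on A (T w)" for A w
    using continuous_on_compose2[OF contT[of UNIV], of A "\<lambda>t. (w, t)"] by (simp add: continuous_intros)
  define h where "h j w = integral {0..1} (\<lambda>t. partial j f (T w t))" for j w
  have p: "holomorphic_fun_on (partial j f) (ball w0 r)" for j
    by (rule partial_holomorphic[OF f]) simp
  have contp: "continuous_on {0..1} (\<lambda>t. partial j f (T w t))" if "w \<in> ball w0 r" for j w
    by (rule continuous_on_compose2[OF holomorphic_fun_on_imp_continuous_on[OF p] contT0])
      (use T_ball that in auto)
  have 1: "holomorphic_fun_on (h j) (ball w0 r)" for j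
    unfolding h_def
  proof (rule holomorphic_fun_on_integral)
    fix w and t :: real assume w: "w \<in> ball w0 r" "t \<in> {0..1}"
    define A where "A = grad (partial j f) (T w t)"
    have A: "(partial j f has_derivative linform A) (at (T w t))"
      using p T_ball[OF w] by (auto simp: holomorphic_fun_on_iff_grad A_def)
    have T': "((\<lambda>w. T w t) has_derivative (\<lambda>v. T v t)) (at w)"
    proof (rule has_derivative_vec_componentwise)
      show "((\<lambda>z. T z t $ k) has_derivative (\<lambda>v. T v t $ k)) (at w)" for k
        by (cases "k \<in> S") (auto simp: T_def intro!: derivative_intros
            bounded_linear.has_derivative[OF bounded_linear_vec_nth])
    qed
    have "linform (T A t) = (\<lambda>v. linform A (T v t))"
      by (auto simp: fun_eq_iff linform_def T_def intro!: sum.cong)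
    with has_derivative_compose[OF T' A]
    show "((\<lambda>z. partial j f (T z t)) has_derivative linform (T (grad (partial j f) (T w t)) t)) (at w)"
      by (simp add: A_def)
  next
    have "continuous_on (ball w0 r \<times> {0..1}) (\<lambda>x. grad (partial j f) (T (fst x) (snd x)))"
      by (rule continuous_on_compose2[OF grad_continuous_on[OF p] contT]) (use T_ball in auto)
    from continuous_on_compose2[OF contT[of UNIV] continuous_on_Pair[OF this continuous_on_snd[OF continuous_on_id]]]
    show "continuous_on (ball w0 r \<times> {0..1}) (\<lambda>(z, t). T (grad (partial j f) (T z t)) t)"
      by (simp add: case_prod_unfold)
  qed (use contp in auto)
  have 2: "h j w0 = partial j f w0" for j
  proof -
    have "T w0 t = w0" for t using w0 by (auto simp: T_def vec_eq_iff)
    then show ?thesis by (simp add: h_def)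
  qed
  have 3: "f w = (\<Sum>j\<in>-S. w $ j * h j w)" if w: "w \<in> ball w0 r" for w
  proof -
    define u where "u = (\<chi> j. if j \<in> S then 0 else w $ j)"
    have T': "((\<lambda>t. T w t) has_derivative (\<lambda>t. t *\<^sub>R u)) (at t within {0..1})" for t
    proof (rule has_derivative_vec_componentwise)
      fix k
      have "((\<lambda>t. of_real t * w $ k) has_derivative (\<lambda>t. of_real t * w $ k)) (at t within {0..1})"
        by (intro has_derivative_mult_left has_derivative_of_real has_derivative_ident)
      then show "((\<lambda>t. T w t $ k) has_derivative (\<lambda>t. (t *\<^sub>R u) $ k)) (at t within {0..1})"
        unfolding vector_scaleR_component scaleR_conv_of_real[of _ "u $ k"]
        by (cases "k \<in> S") (simp_all add: T_def u_def)
    qed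
    have "((\<lambda>t. f (T w t)) has_vector_derivative linform (grad f (T w t)) u) (at t within {0..1})"
      if t: "t \<in> {0..1}" for t
    proof -
      have "(f has_derivative linform (grad f (T w t))) (at (T w t))"
        using f T_ball[OF w t] by (auto simp: holomorphic_fun_on_iff_grad)
      from has_derivative_compose[OF T' this]
      show ?thesis
        unfolding has_vector_derivative_def
        by (simp add: linear_simps[OF bounded_linear_linform])
    qed
    then have "((\<lambda>t. linform (grad f (T w t)) u) has_integral f (T w 1) - f (T w 0)) {0..1}"
      by (intro fundamental_theorem_of_calculus) auto
    moreover have "f (T w 0) = 0"
      using van[OF T_ball[OF w, of 0]] by (simp add: T_def)
    moreover have "T w 1 = w" by (simp add: T_def vec_eq_iff)
    ultimately have "f w = integral {0..1} (\<lambda>t. linform (grad f (T w t)) u)"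
      by (simp add: integral_unique)
    also have "\<dots> = integral {0..1} (\<lambda>t. \<Sum>j\<in>-S. w $ j * partial j f (T w t))"
    proof (rule integral_cong)
      fix t
      have "linform (grad f (T w t)) u = (\<Sum>j\<in>UNIV. if j \<in> S then 0 else w $ j * partial j f (T w t))"
        unfolding linform_def grad_def u_def by (intro sum.cong) auto
      also have "\<dots> = (\<Sum>j\<in>-S. w $ j * partial j f (T w t))"
        by (rule sum.mono_neutral_cong_right) auto
      finally show "linform (grad f (T w t)) u = (\<Sum>j\<in>-S. w $ j * partial j f (T w t))" .
    qed
    also have "\<dots> = (\<Sum>j\<in>-S. w $ j * h j w)"
      unfolding h_def
      by (subst integral_sum) (auto intro!: integrable_continuous_interval continuous_intros contp w)
    finally show ?thesis .
  qed
  show ?thesis using that[OF 1 2 3] .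
qed

section \<open>Local calculus of holomorphic functions\<close>

definition holomorphic_at :: "(complex^'n \<Rightarrow> complex) \<Rightarrow> complex^'n \<Rightarrow> bool" where
  "holomorphic_at f p \<longleftrightarrow> (\<exists>U. open U \<and> p \<in> U \<and> holomorphic_fun_on f U)"

lemma holomorphic_at_iff_eventually:
  "holomorphic_at f p \<longleftrightarrow> (\<forall>\<^sub>F z in nhds p. \<exists>A. (f has_derivative linform A) (at z))"
  unfolding holomorphic_at_def holomorphic_fun_on_def linform_def[symmetric, abs_def] eventually_nhds
  by blast

lemma holomorphic_at_has_derivative:
  "holomorphic_at f p \<Longrightarrow> (f has_derivative linform (grad f p)) (at p)"
  unfolding holomorphic_at_def holomorphic_fun_on_iff_grad by blast

text \<open>
  All derivative-based notions at points near \<open>p\<close> depend only on the germ at \<open>p\<close>, because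
  functions that agree near \<open>p\<close> agree near each point that is close to \<open>p\<close>.
\<close>

lemma eventually_has_derivative_cong:
  assumes "\<forall>\<^sub>F z in nhds p. f z = g z"
  shows "\<forall>\<^sub>F z in nhds p. \<forall>D. (f has_derivative D) (at z) \<longleftrightarrow> (g has_derivative D) (at z)"
proof -
  have *: "(h has_derivative D) (at z)" if "(k has_derivative D) (at z)" "\<forall>\<^sub>F z in nhds z. k z = h z" for h k D z
  proof (rule has_derivative_transform_eventually[OF that(1)])
    show "\<forall>\<^sub>F z in at z. k z = h z"
      unfolding eventually_at_filter by (rule eventually_mono[OF that(2)]) simp
    show "k z = h z" using that(2) by (rule eventually_nhds_x_imp_x)
  qed simp
  have "\<forall>\<^sub>F z in nhds p. \<forall>\<^sub>F z in nhds z. f z = g z"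
    using assms by (simp add: eventually_eventually)
  then show ?thesis
  proof eventually_elim
    case (elim z)
    then have "\<forall>\<^sub>F z in nhds z. g z = f z" by (simp add: eq_commute)
    with elim show ?case using * by blast
  qed
qed

lemma holomorphic_at_cong:
  assumes "\<forall>\<^sub>F z in nhds p. f z = g z"
  shows "holomorphic_at f p \<longleftrightarrow> holomorphic_at g p"
  unfolding holomorphic_at_iff_eventually
  by (rule eventually_cong[OF eventually_has_derivative_cong[OF assms]]) blast

lemma eventually_partial_cong:
  assumes "\<forall>\<^sub>F z in nhds p. f z = g z"
  shows "\<forall>\<^sub>F z in nhds p. \<forall>i. partial i f z = partial i g z"
  using eventually_has_derivative_cong[OF assms]
  by (rule eventually_mono) (simp add: partial_def frechet_derivative_def)

lemma grad_cong:
  assumes "\<forall>\<^sub>F z in nhds p. f z = g z"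
  shows "grad f p = grad g p"
  using eventually_nhds_x_imp_x[OF eventually_partial_cong[OF assms]] by (simp add: grad_def)

lemma eventually_has_derivative_grad:
  "holomorphic_at f p \<Longrightarrow> \<forall>\<^sub>F z in nhds p. (f has_derivative linform (grad f z)) (at z)"
  unfolding holomorphic_at_iff_eventually
  by (erule eventually_mono) (metis has_derivative_linform_unique(2))

lemma has_derivative_linform_add:
  assumes "(f has_derivative linform A) F" "(g has_derivative linform B) F"
  shows "((\<lambda>z. f z + g z) has_derivative linform (A + B)) F"
proof -
  have "linform (A + B) = (\<lambda>v. linform A v + linform B v)"
    by (rule ext) (simp add: linform_def distrib_right sum.distrib)
  then show ?thesis using has_derivative_add[OF assms] by simp
qed

lemma has_derivative_linform_mult:
  assumes "(f has_derivative linform A) (at z)" "(g has_derivative linform B) (at z)"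
  shows "((\<lambda>z. f z * g z) has_derivative linform (f z *s B + g z *s A)) (at z)"
proof -
  have "linform (f z *s B + g z *s A) = (\<lambda>v. f z * linform B v + linform A v * g z)"
    by (rule ext) (simp add: linform_def algebra_simps sum.distrib sum_distrib_left)
  then show ?thesis using has_derivative_mult[OF assms] by simp
qed

lemma has_derivative_linform_const: "((\<lambda>z. c) has_derivative linform 0) F"
proof -
  have "linform 0 = (\<lambda>v :: complex^'a. 0)" by (rule ext) (simp add: linform_def)
  then show ?thesis by simp
qed

lemma holomorphic_at_const [simp]: "holomorphic_at (\<lambda>_. c) p"
  unfolding holomorphic_at_iff_eventually using has_derivative_linform_const by (intro always_eventually) blast

lemma holomorphic_at_add:
  "holomorphic_at f p \<Longrightarrow> holomorphic_at g p \<Longrightarrow> holomorphic_at (\<lambda>z. f z + g z) p"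
  unfolding holomorphic_at_iff_eventually
  by (erule eventually_elim2, assumption) (blast intro: has_derivative_linform_add)

lemma holomorphic_at_mult:
  "holomorphic_at f p \<Longrightarrow> holomorphic_at g p \<Longrightarrow> holomorphic_at (\<lambda>z. f z * g z) p"
  unfolding holomorphic_at_iff_eventually
  by (erule eventually_elim2, assumption) (blast intro: has_derivative_linform_mult)

lemma holomorphic_at_uminus: "holomorphic_at f p \<Longrightarrow> holomorphic_at (\<lambda>z. - f z) p"
  using holomorphic_at_mult[OF holomorphic_at_const[of "-1"], of f p] by simp

lemma holomorphic_at_sum:
  "(\<And>i. i \<in> A \<Longrightarrow> holomorphic_at (f i) p) \<Longrightarrow> holomorphic_at (\<lambda>z. \<Sum>i\<in>A. f i z) p"
  by (induction A rule: infinite_finite_induct) (auto intro: holomorphic_at_add)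

lemma holomorphic_at_prod:
  "(\<And>i. i \<in> A \<Longrightarrow> holomorphic_at (f i) p) \<Longrightarrow> holomorphic_at (\<lambda>z. \<Prod>i\<in>A. f i z) p"
  by (induction A rule: infinite_finite_induct) (auto intro: holomorphic_at_mult)

lemmas holomorphic_at_intros = holomorphic_at_const holomorphic_at_add
  holomorphic_at_mult holomorphic_at_uminus holomorphic_at_sum holomorphic_at_prod

lemma holomorphic_at_partial: "holomorphic_at f p \<Longrightarrow> holomorphic_at (partial i f) p"
  unfolding holomorphic_at_def using partial_holomorphic by blast

lemma grad_add:
  assumes "holomorphic_at f p" "holomorphic_at g p"
  shows "grad (\<lambda>z. f z + g z) p = grad f p + grad g p"
  by (rule has_derivative_linform_unique(2))
    (intro has_derivative_linform_add holomorphic_at_has_derivative assms)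

lemma grad_mult:
  assumes "holomorphic_at f p" "holomorphic_at g p"
  shows "grad (\<lambda>z. f z * g z) p = f p *s grad g p + g p *s grad f p"
  by (rule has_derivative_linform_unique(2))
    (intro has_derivative_linform_mult holomorphic_at_has_derivative assms)

lemma grad_const [simp]: "grad (\<lambda>z. c) p = 0"
  by (rule has_derivative_linform_unique(2)) (rule has_derivative_linform_const)

lemma grad_sum:
  assumes "\<And>i. i \<in> A \<Longrightarrow> holomorphic_at (f i) p"
  shows "grad (\<lambda>z. \<Sum>i\<in>A. f i z) p = (\<Sum>i\<in>A. grad (f i) p)"
  using assms by (induction A rule: infinite_finite_induct) (auto simp: grad_add holomorphic_at_sum)

text \<open>
  The differential, taken componentwise so that it is complex linear by its very form.
\<close>

definition tangent_map :: "(complex^'n \<Rightarrow> complex^'m) \<Rightarrow> complex^'n \<Rightarrow> complex^'n \<Rightarrow> complex^'m" where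
  "tangent_map F z v = (\<chi> k. linform (grad (\<lambda>z. F z $ k) z) v)"

lemma has_derivative_tangent_map:
  assumes "\<And>k. holomorphic_at (\<lambda>z. F z $ k) p"
  shows "(F has_derivative tangent_map F p) (at p)"
  by (rule has_derivative_vec_componentwise)
    (simp add: tangent_map_def holomorphic_at_has_derivative assms)

lemma linform_tangent_map:
  "linform A (tangent_map F z v) = linform (\<chi> i. \<Sum>k\<in>UNIV. A $ k * grad (\<lambda>z. F z $ k) z $ i) v"
  unfolding linform_def tangent_map_def
  by (simp add: sum_distrib_left sum_distrib_right mult_ac) (rule sum.swap)

lemma eventually_compose_isCont:
  fixes F :: "'a::t2_space \<Rightarrow> 'b::topological_space"
  assumes "\<forall>\<^sub>F w in nhds (F p). P w" "isCont F p"
  shows "\<forall>\<^sub>F z in nhds p. P (F z)"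
proof (rule eventually_compose_filterlim[OF assms(1)])
  show "filterlim F (nhds (F p)) (nhds p)"
    using assms(2) by (simp add: continuous_within tendsto_at_iff_tendsto_nhds)
qed

lemma holomorphic_at_compose:
  assumes f: "holomorphic_at f (F p)" and F: "\<And>k. holomorphic_at (\<lambda>z. F z $ k) p"
  shows "holomorphic_at (\<lambda>z. f (F z)) p" 
    and "linform (grad (\<lambda>z. f (F z)) p) v = linform (grad f (F p)) (tangent_map F p v)"
proof -
  have ch: "((\<lambda>z. f (F z)) has_derivative linform (\<chi> i. \<Sum>k\<in>UNIV. grad f (F z) $ k * grad (\<lambda>z. F z $ k) z $ i)) (at z)"
    if "(f has_derivative linform (grad f (F z))) (at (F z))"
      "\<forall>k. ((\<lambda>z. F z $ k) has_derivative linform (grad (\<lambda>z. F z $ k) z)) (at z)" for z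
  proof -
    have "(F has_derivative tangent_map F z) (at z)"
      by (rule has_derivative_vec_componentwise) (use that in \<open>simp add: tangent_map_def\<close>)
    from has_derivative_compose[OF this that(1)] show ?thesis
      by (simp add: linform_tangent_map)
  qed
  have "\<forall>\<^sub>F z in nhds p. (f has_derivative linform (grad f (F z))) (at (F z))"
  proof (rule eventually_compose_isCont[where F = F and P = "\<lambda>w. (f has_derivative linform (grad f w)) (at w)",
        OF eventually_has_derivative_grad[OF f]])
    show "isCont F p" using has_derivative_tangent_map[OF F] has_derivative_continuous by blast
  qed
  moreover have "\<forall>\<^sub>F z in nhds p. \<forall>k. ((\<lambda>z. F z $ k) has_derivative linform (grad (\<lambda>z. F z $ k) z)) (at z)"
    using F by (intro eventually_all_finite eventually_has_derivative_grad)
  ultimately show "holomorphic_at (\<lambda>z. f (F z)) p"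
    unfolding holomorphic_at_iff_eventually by eventually_elim (use ch in blast)
  from ch[of p] show "linform (grad (\<lambda>z. f (F z)) p) v = linform (grad f (F p)) (tangent_map F p v)"
    using f F by (simp add: holomorphic_at_has_derivative has_derivative_linform_unique(2) linform_tangent_map)
qed

lemma tangent_map_linear:
  "tangent_map F z (v + w) = tangent_map F z v + tangent_map F z w"
  "tangent_map F z (c *s v) = c *s tangent_map F z v"
  by (simp_all add: tangent_map_def vec_eq_iff linform_add linform_scale)

lemma tangent_map_compose:
  assumes G: "\<And>k. holomorphic_at (\<lambda>z. G z $ k) (F p)" and F: "\<And>k. holomorphic_at (\<lambda>z. F z $ k) p"
  shows "tangent_map (\<lambda>z. G (F z)) p v = tangent_map G (F p) (tangent_map F p v)"
  using holomorphic_at_compose(2)[of "\<lambda>z. G z $ _" F p v, OF G F]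
  by (simp add: tangent_map_def[of G] tangent_map_def[of "\<lambda>z. G (F z)"])

lemma tangent_map_ident [simp]: "tangent_map (\<lambda>z. z) p v = v"
proof -
  have "grad (\<lambda>z. z $ k) p = axis k 1" for k
    by (rule has_derivative_linform_unique(2)) (rule vec_nth_has_derivative_linform)
  then show ?thesis by (simp add: tangent_map_def linform_axis_left)
qed

lemma tangent_map_cong:
  assumes "\<forall>\<^sub>F z in nhds p. F z = G z"
  shows "tangent_map F p = tangent_map G p"
proof -
  have "grad (\<lambda>z. F z $ k) p = grad (\<lambda>z. G z $ k) p" for k
    by (rule grad_cong, rule eventually_mono[OF assms]) simp
  then show ?thesis by (simp add: tangent_map_def[abs_def])
qed

section \<open>The ring of germs\<close>

lemma mem_germ: "f \<in> germ p f"
  by (simp add: germ_def)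

lemma germ_eq_iff: "germ p f = germ p g \<longleftrightarrow> (\<forall>\<^sub>F z in nhds p. f z = g z)"
proof
  assume "germ p f = germ p g"
  then show "\<forall>\<^sub>F z in nhds p. f z = g z" using mem_germ[of f p] by (simp add: germ_def)
next
  assume *: "\<forall>\<^sub>F z in nhds p. f z = g z"
  show "germ p f = germ p g"
    unfolding germ_def
  proof (rule Collect_cong, rule eventually_subst)
    fix h show "\<forall>\<^sub>F z in nhds p. (h z = f z) = (h z = g z)"
      using * by eventually_elim simp
  qed
qed

lemma eventually_rep_germ: "\<forall>\<^sub>F z in nhds p. rep (germ p f) z = f z"
  using someI[of "\<lambda>g. g \<in> germ p f", OF mem_germ] unfolding rep_def[symmetric] by (simp add: germ_def)

lemma germ_val_germ [simp]: "germ_val p (germ p f) = f p"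
  unfolding germ_val_def using eventually_nhds_x_imp_x[OF eventually_rep_germ] .

lemma germ_cong: "(\<forall>\<^sub>F z in nhds p. f z = g z) \<Longrightarrow> germ p f = germ p g"
  by (simp add: germ_eq_iff)

lemma germ_rep_germ: "germ p (rep (germ p f)) = germ p f"
  by (rule germ_cong) (rule eventually_rep_germ)

lemma germ_in_carrier_iff [simp]: "germ p f \<in> carrier (germ_ring p) \<longleftrightarrow> holomorphic_at f p"
  unfolding germ_ring_def using holomorphic_at_cong
  by (auto simp: holomorphic_at_def[symmetric] germ_eq_iff) (rule exI[of _ f], simp)

lemma germ_ringE:
  assumes "a \<in> carrier (germ_ring p)"
  obtains f where "a = germ p f" "holomorphic_at f p"
  using assms unfolding germ_ring_def holomorphic_at_def by auto

lemma germ_mult [simp]: "germ p f \<otimes>\<^bsub>germ_ring p\<^esub> germ p g = germ p (\<lambda>z. f z * g z)"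
  unfolding germ_ring_def
  by (simp, rule germ_cong, use eventually_rep_germ[of p f] eventually_rep_germ[of p g] in eventually_elim) simp

lemma germ_add [simp]: "germ p f \<oplus>\<^bsub>germ_ring p\<^esub> germ p g = germ p (\<lambda>z. f z + g z)"
  unfolding germ_ring_def
  by (simp, rule germ_cong, use eventually_rep_germ[of p f] eventually_rep_germ[of p g] in eventually_elim) simp

lemma germ_one: "\<one>\<^bsub>germ_ring p\<^esub> = germ p (\<lambda>_. 1)"
  and germ_zero: "\<zero>\<^bsub>germ_ring p\<^esub> = germ p (\<lambda>_. 0)"
  by (simp_all add: germ_ring_def)

lemma cring_germ_ring: "cring (germ_ring p)"
proof (rule cringI)
  show "abelian_group (germ_ring p)"
  proof (rule abelian_groupI)
    fix a assume "a \<in> carrier (germ_ring p)"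
    then obtain f where f: "a = germ p f" "holomorphic_at f p" by (rule germ_ringE)
    then show "\<exists>b\<in>carrier (germ_ring p). b \<oplus>\<^bsub>germ_ring p\<^esub> a = \<zero>\<^bsub>germ_ring p\<^esub>"
      by (intro bexI[of _ "germ p (\<lambda>z. - f z)"]) (simp_all add: germ_zero holomorphic_at_uminus)
  qed (auto elim!: germ_ringE simp: germ_zero holomorphic_at_intros add_ac)
  show "Group.comm_monoid (germ_ring p)"
    by (rule Group.comm_monoidI) (auto elim!: germ_ringE simp: germ_one holomorphic_at_intros mult_ac)
qed (auto elim!: germ_ringE simp: holomorphic_at_intros distrib_right)

lemma germ_uminus:
  assumes "holomorphic_at f p"
  shows "\<ominus>\<^bsub>germ_ring p\<^esub> germ p f = germ p (\<lambda>z. - f z)"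
proof -
  interpret cring "germ_ring p" by (rule cring_germ_ring)
  show ?thesis
    by (rule minus_equality) (simp_all add: assms holomorphic_at_uminus germ_zero)
qed

lemma germ_finsum:
  assumes "finite A" "\<And>i. i \<in> A \<Longrightarrow> holomorphic_at (f i) p"
  shows "finsum (germ_ring p) (\<lambda>i. germ p (f i)) A = germ p (\<lambda>z. \<Sum>i\<in>A. f i z)"
proof -
  interpret cring "germ_ring p" by (rule cring_germ_ring)
  show ?thesis using assms
  proof (induction A rule: finite_induct)
    case (insert i A)
    then show ?case by (subst finsum_insert) (auto)
  qed (simp add: germ_zero)
qed

lemma germ_finprod:
  assumes "finite A" "\<And>i. i \<in> A \<Longrightarrow> holomorphic_at (f i) p"
  shows "finprod (germ_ring p) (\<lambda>i. germ p (f i)) A = germ p (\<lambda>z. \<Prod>i\<in>A. f i z)"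
proof -
  interpret cring "germ_ring p" by (rule cring_germ_ring)
  show ?thesis using assms
  proof (induction A rule: finite_induct)
    case (insert i A)
    then show ?case by (subst finprod_insert) (auto)
  qed (simp add: germ_one)
qed

section \<open>The module of germs of vector fields\<close>

definition holomorphic_map_at :: "(complex^'n \<Rightarrow> complex^'m) \<Rightarrow> complex^'n \<Rightarrow> bool" where
  "holomorphic_map_at F p \<longleftrightarrow> (\<forall>i. holomorphic_at (\<lambda>z. F z $ i) p)"

lemma holomorphic_map_at_iff:
  "holomorphic_map_at F p \<longleftrightarrow> (\<exists>U. open U \<and> p \<in> U \<and> holomorphic_map_on F U)"
proof
  assume "holomorphic_map_at F p"
  then obtain U where U: "\<And>i. open (U i) \<and> p \<in> U i \<and> holomorphic_fun_on (\<lambda>z. F z $ i) (U i)"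
    unfolding holomorphic_map_at_def holomorphic_at_def by metis
  then show "\<exists>U. open U \<and> p \<in> U \<and> holomorphic_map_on F U"
    unfolding holomorphic_map_on_def
    by (intro exI[of _ "\<Inter>i. U i"]) (auto intro!: open_INT intro: holomorphic_fun_on_subset)
qed (auto simp: holomorphic_map_at_def holomorphic_at_def holomorphic_map_on_def)

lemma holomorphic_map_at_cong:
  assumes "\<forall>\<^sub>F z in nhds p. F z = G z"
  shows "holomorphic_map_at F p \<longleftrightarrow> holomorphic_map_at G p"
proof -
  have "holomorphic_at (\<lambda>z. F z $ i) p \<longleftrightarrow> holomorphic_at (\<lambda>z. G z $ i) p" for i
    by (rule holomorphic_at_cong, rule eventually_mono[OF assms]) simp
  then show ?thesis by (simp add: holomorphic_map_at_def)
qed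

lemma germ_in_der_iff [simp]: "germ p F \<in> carrier (der_module p) \<longleftrightarrow> holomorphic_map_at F p"
  unfolding der_module_def using holomorphic_map_at_cong
  by (auto simp: holomorphic_map_at_iff[symmetric] germ_eq_iff) (rule exI[of _ F], simp)

lemma der_moduleE:
  assumes "\<xi> \<in> carrier (der_module p)"
  obtains F where "\<xi> = germ p F" "holomorphic_map_at F p"
  using assms unfolding der_module_def holomorphic_map_at_iff by auto

lemma der_add [simp]: "germ p F \<oplus>\<^bsub>der_module p\<^esub> germ p G = germ p (\<lambda>z. F z + G z)"
  unfolding der_module_def
  by (simp, rule germ_cong, use eventually_rep_germ[of p F] eventually_rep_germ[of p G] in eventually_elim) simp

lemma der_smult [simp]: "germ p f \<odot>\<^bsub>der_module p\<^esub> germ p G = germ p (\<lambda>z. f z *s G z)"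
  unfolding der_module_def
  by (simp, rule germ_cong, use eventually_rep_germ[of p f] eventually_rep_germ[of p G] in eventually_elim) simp

lemma der_zero: "\<zero>\<^bsub>der_module p\<^esub> = germ p (\<lambda>_. 0)"
  by (simp add: der_module_def)

lemma holomorphic_map_at_intros:
  "holomorphic_map_at (\<lambda>_. c) p"
  "holomorphic_map_at F p \<Longrightarrow> holomorphic_map_at G p \<Longrightarrow> holomorphic_map_at (\<lambda>z. F z + G z) p"
  "holomorphic_map_at F p \<Longrightarrow> holomorphic_map_at (\<lambda>z. - F z) p"
  "holomorphic_at f p \<Longrightarrow> holomorphic_map_at G p \<Longrightarrow> holomorphic_map_at (\<lambda>z. f z *s G z) p"
  by (simp_all add: holomorphic_map_at_def holomorphic_at_intros)

lemma module_der: "module (germ_ring p) (der_module p)"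
proof (rule moduleI)
  show "abelian_group (der_module p)"
  proof (rule abelian_groupI)
    fix \<xi> assume "\<xi> \<in> carrier (der_module p)"
    then obtain F where F: "\<xi> = germ p F" "holomorphic_map_at F p" by (rule der_moduleE)
    then show "\<exists>\<eta>\<in>carrier (der_module p). \<eta> \<oplus>\<^bsub>der_module p\<^esub> \<xi> = \<zero>\<^bsub>der_module p\<^esub>"
      by (intro bexI[of _ "germ p (\<lambda>z. - F z)"])
        (simp_all add: der_zero holomorphic_map_at_intros vec_eq_iff)
  qed (auto elim!: der_moduleE simp: der_zero holomorphic_map_at_intros add_ac)
qed (auto elim!: der_moduleE germ_ringE simp: germ_one cring_germ_ring holomorphic_map_at_intros holomorphic_at_intros
      vector_add_ldistrib vector_sadd_rdistrib vector_smult_assoc)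

lemma der_apply_germ [simp]:
  "der_apply p (germ p F) (germ p f) = germ p (\<lambda>z. \<Sum>i\<in>UNIV. F z $ i * partial i f z)"
  unfolding der_apply_def
  by (rule germ_cong, use eventually_rep_germ[of p F] eventually_partial_cong[OF eventually_rep_germ[of p f]] in eventually_elim) simp

lemma linear_part_germ:
  assumes "holomorphic_map_at F p"
  shows "linear_part p (germ p F) = tangent_map F p"
proof -
  have ev: "\<forall>\<^sub>F z in nhds p. rep (germ p F) z $ i = F z $ i" for i
    using eventually_rep_germ[of p F] by eventually_elim simp
  have h: "holomorphic_at (\<lambda>z. rep (germ p F) z $ i) p" for i
    using holomorphic_at_cong[OF ev] assms by (simp add: holomorphic_map_at_def)
  show ?thesis
    unfolding linear_part_def[abs_def] tangent_map_def[abs_def]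
    using has_derivative_linform_unique(1)[OF holomorphic_at_has_derivative[OF h]]
    by (simp add: grad_cong[OF ev])
qed

definition germ_grad :: "complex^'n \<Rightarrow> ('n, complex) germ \<Rightarrow> complex^'n" where
  "germ_grad p a = grad (rep a) p"

lemma germ_grad_germ [simp]: "germ_grad p (germ p f) = grad f p"
  unfolding germ_grad_def by (rule grad_cong) (rule eventually_rep_germ)

section \<open>Determinants indexed by natural numbers\<close>

text \<open>
  Minors of varying size need determinants whose index set is not a type.
\<close>

definition nat_det :: "nat \<Rightarrow> (nat \<Rightarrow> nat \<Rightarrow> complex) \<Rightarrow> complex" where
  "nat_det k A = Determinant.det (Matrix.mat k k (\<lambda>(i, j). A i j))"

lemma nat_det_cong: "(\<And>i j. i < k \<Longrightarrow> j < k \<Longrightarrow> A i j = B i j) \<Longrightarrow> nat_det k A = nat_det k B"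
  unfolding nat_det_def by (rule arg_cong[of _ _ Determinant.det]) auto

lemma nat_det_perm_sum:
  "nat_det k A = (\<Sum>\<pi> | \<pi> permutes {..<k}. (if evenperm \<pi> then 1 else -1) * (\<Prod>i<k. A i (\<pi> i)))"
proof -
  have "nat_det k A = (\<Sum>\<pi> | \<pi> permutes {0..<k}. signof \<pi> * (\<Prod>i = 0..<k. A i (\<pi> i)))"
    unfolding nat_det_def
    by (subst det_def'[of _ k]) (auto intro!: sum.cong prod.cong dest: permutes_in_image)
  also have "\<dots> = (\<Sum>\<pi> | \<pi> permutes {..<k}. (if evenperm \<pi> then 1 else -1) * (\<Prod>i<k. A i (\<pi> i)))"
    by (intro sum.cong) (auto simp: sign_def lessThan_atLeast0)
  finally show ?thesis .
qed

text \<open>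
  The determinant is linear in column \<open>j\<close>; the coefficients, cofactors, do not see that column.
\<close>

lemma nat_det_col_expand:
  assumes "j < k"
  shows "\<exists>C. \<forall>b. nat_det k (\<lambda>i l. if l = j then b i else A i l) = (\<Sum>i<k. b i * C i)"
proof -
  define M where "M b = Matrix.mat k k (\<lambda>(i, l). if l = j then b i else A i l)" for b
  have "nat_det k (\<lambda>i l. if l = j then b i else A i l) = (\<Sum>i<k. b i * cofactor (M (\<lambda>_. 0)) i j)" for b
  proof -
    have "nat_det k (\<lambda>i l. if l = j then b i else A i l) = (\<Sum>i<k. M b $$ (i, j) * cofactor (M b) i j)"
      unfolding nat_det_def M_def[symmetric]
      by (rule laplace_expansion_column) (use assms in \<open>auto simp: M_def\<close>)
    also have "\<dots> = (\<Sum>i<k. b i * cofactor (M (\<lambda>_. 0)) i j)"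
    proof (intro sum.cong arg_cong2[where f = "(*)"] refl)
      fix i assume i: "i \<in> {..<k}"
      have "mat_delete (M b) i j = mat_delete (M (\<lambda>_. 0)) i j"
        using assms i by (intro eq_matI) (auto simp: mat_delete_def M_def)
      then show "cofactor (M b) i j = cofactor (M (\<lambda>_. 0)) i j" by (simp add: cofactor_def)
      show "M b $$ (i, j) = b i" using assms i by (simp add: M_def)
    qed
    finally show ?thesis .
  qed
  then show ?thesis by (intro exI[of _ "\<lambda>i. cofactor (M (\<lambda>_. 0)) i j"] allI)
qed

text \<open>
  As for columns, but the coefficient at the diagonal position is needed as a smaller determinant
  of the same kind, for the induction on the size in \<open>exists_nonzero_minor\<close>.
\<close>

lemma nat_det_row_expand:
  assumes "k' < k"
  shows "\<exists>C. (\<forall>b. nat_det k (\<lambda>i l. if i = k' then b l else A i l) = (\<Sum>l<k. b l * C l)) \<and>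
    C k' = nat_det (k - 1) (\<lambda>i l. A (if i < k' then i else Suc i) (if l < k' then l else Suc l))"
proof -
  define M where "M b = Matrix.mat k k (\<lambda>(i, l). if i = k' then b l else A i l)" for b
  have 1: "nat_det k (\<lambda>i l. if i = k' then b l else A i l) = (\<Sum>l<k. b l * cofactor (M (\<lambda>_. 0)) k' l)" for b
  proof -
    have "nat_det k (\<lambda>i l. if i = k' then b l else A i l) = (\<Sum>l<k. M b $$ (k', l) * cofactor (M b) k' l)"
      unfolding nat_det_def M_def[symmetric]
      by (rule laplace_expansion_row) (use assms in \<open>auto simp: M_def\<close>)
    also have "\<dots> = (\<Sum>l<k. b l * cofactor (M (\<lambda>_. 0)) k' l)"
    proof (intro sum.cong arg_cong2[where f = "(*)"] refl)
      fix l assume l: "l \<in> {..<k}"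
      have "mat_delete (M b) k' l = mat_delete (M (\<lambda>_. 0)) k' l"
        using assms l by (intro eq_matI) (auto simp: mat_delete_def M_def)
      then show "cofactor (M b) k' l = cofactor (M (\<lambda>_. 0)) k' l" by (simp add: cofactor_def)
      show "M b $$ (k', l) = b l" using assms l by (simp add: M_def)
    qed
    finally show ?thesis .
  qed
  have "mat_delete (M (\<lambda>_. 0)) k' k' =
    Matrix.mat (k - 1) (k - 1) (\<lambda>(i, l). A (if i < k' then i else Suc i) (if l < k' then l else Suc l))"
    using assms by (intro eq_matI) (auto simp: mat_delete_def M_def)
  then have 2: "cofactor (M (\<lambda>_. 0)) k' k' =
     nat_det (k - 1) (\<lambda>i l. A (if i < k' then i else Suc i) (if l < k' then l else Suc l))"
    by (simp add: cofactor_def nat_det_def)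
  show ?thesis
    by (rule exI[of _ "\<lambda>l. cofactor (M (\<lambda>_. 0)) k' l"], intro conjI allI 1 2)
qed

text \<open>
  Cramer's rule.
\<close>

lemma nat_det_replace_col:
  assumes "j < k"
  shows "nat_det k (\<lambda>i l. if l = j then (\<Sum>m<k. x m * A i m) else A i l) = x j * nat_det k A"
proof -
  \<comment> \<open>\<open>cramer_lemma_mat\<close> for the right-hand side \<open>A x\<close>.\<close>
  define M where "M = Matrix.mat k k (\<lambda>(i, j). A i j)"
  have "Determinant.det (replace_col M (M *\<^sub>v Matrix.vec k x) j) = vec_index (Matrix.vec k x) j * Determinant.det M"
    by (rule cramer_lemma_mat) (use assms in \<open>auto simp: M_def\<close>)
  moreover have "replace_col M (M *\<^sub>v Matrix.vec k x) j =
      Matrix.mat k k (\<lambda>(i, l). if l = j then (\<Sum>m<k. x m * A i m) else A i l)"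
    by (rule eq_matI) (auto simp: replace_col_def M_def scalar_prod_def lessThan_atLeast0 mult.commute intro!: sum.cong)
  ultimately show ?thesis
    using assms by (simp add: nat_det_def M_def)
qed

lemma nat_det_dependent_cols:
  assumes "\<And>i. i < k \<Longrightarrow> (\<Sum>j<k. x j * A i j) = 0" and "j < k" "x j \<noteq> 0"
  shows "nat_det k A = 0"
proof -
  have "x j * nat_det k A = nat_det k (\<lambda>i l. if l = j then 0 else A i l)"
    by (subst nat_det_replace_col[OF assms(2), of x A, symmetric], rule nat_det_cong) (simp add: assms(1))
  also have "\<dots> = 0"
  proof -
    obtain C where "\<forall>b. nat_det k (\<lambda>i l. if l = j then b i else A i l) = (\<Sum>i<k. b i * C i)"
      using nat_det_col_expand[OF assms(2), of A] by blast
    from this[rule_format, of "\<lambda>_. 0"] show ?thesis by simp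
  qed
  finally show ?thesis using assms(3) by simp
qed

lemma nat_det_eq_cols:
  assumes "j < k" "l < k" "j \<noteq> l" "\<And>i. i < k \<Longrightarrow> A i j = A i l"
  shows "nat_det k A = 0"
proof (rule nat_det_dependent_cols[of k "\<lambda>m. if m = j then 1 else if m = l then -1 else 0" A j])
  fix i assume i: "i < k"
  have "(\<Sum>m<k. (if m = j then 1 else if m = l then -1 else 0) * A i m)
    = (\<Sum>m\<in>{j, l}. (if m = j then 1 else if m = l then -1 else 0) * A i m)"
    by (rule sum.mono_neutral_right) (use assms in auto)
  also have "\<dots> = 0" using assms i by simp
  finally show "(\<Sum>m<k. (if m = j then 1 else if m = l then -1 else 0) * A i m) = 0" .
qed (use assms in auto)

lemma nat_det_eq_rows:
  assumes "j < k" "l < k" "j \<noteq> l" "\<And>i. i < k \<Longrightarrow> A j i = A l i"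
  shows "nat_det k A = 0"
  unfolding nat_det_def
  by (rule det_identical_rows[of _ k j l]) (use assms in auto)

text \<open>
  Induction on the number of vectors.  Given rows \<open>r\<close> with nonzero determinant for the first
  \<open>k\<close> vectors, append a row \<open>m\<close> and expand along it: the result is \<open>\<Sum> C\<^sub>l u\<^sub>l(m)\<close>, where the
  \<open>C\<^sub>l\<close> do not depend on \<open>m\<close> and \<open>C\<^sub>k \<noteq> 0\<close>.  If it vanished for every \<open>m\<close>, the vectors
  would be dependent.
\<close>

lemma exists_nonzero_minor:
  fixes u :: "nat \<Rightarrow> complex^'n"
  assumes "\<And>x. (\<Sum>j<k. x j *s u j) = 0 \<Longrightarrow> \<forall>j<k. x j = 0"
  shows "\<exists>r. nat_det k (\<lambda>i j. u j $ r i) \<noteq> 0"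
  using assms
proof (induction k)
  case 0
  show ?case by (simp add: nat_det_def det_def)
next
  case (Suc k)
  have "\<forall>j<k. x j = 0" if "(\<Sum>j<k. x j *s u j) = 0" for x
    using Suc.prems[of "\<lambda>j. if j < k then x j else 0"] that by (simp add: less_Suc_eq_le) (metis less_or_eq_imp_le)
  from Suc.IH[OF this] obtain r where r: "nat_det k (\<lambda>i j. u j $ r i) \<noteq> 0" by blast
  obtain C where C: "\<forall>b. nat_det (Suc k) (\<lambda>i l. if i = k then b l else u l $ r i) = (\<Sum>l<Suc k. b l * C l)"
      "C k = nat_det (Suc k - 1) (\<lambda>i l. u (if l < k then l else Suc l) $ r (if i < k then i else Suc i))"
    using nat_det_row_expand[of k "Suc k" "\<lambda>i l. u l $ r i"] by blast
  have Ck: "C k \<noteq> 0"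
  proof -
    have "C k = nat_det k (\<lambda>i j. u j $ r i)"
      unfolding C(2) diff_Suc_1 by (rule nat_det_cong) simp
    then show ?thesis using r by simp
  qed
  have "\<exists>m. (\<Sum>l<Suc k. u l $ m * C l) \<noteq> 0"
  proof (rule ccontr)
    assume "\<not> ?thesis"
    then have "(\<Sum>l<Suc k. C l *s u l) = 0"
      by (auto simp: vec_eq_iff mult.commute)
    from Suc.prems[OF this] Ck show False by blast
  qed
  then obtain m where "(\<Sum>l<Suc k. u l $ m * C l) \<noteq> 0" by blast
  then have "nat_det (Suc k) (\<lambda>i l. if i = k then u l $ m else u l $ r i) \<noteq> 0"
    using C(1)[rule_format, of "\<lambda>l. u l $ m"] by simp
  then have "nat_det (Suc k) (\<lambda>i l. u l $ (r(k := m)) i) \<noteq> 0"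
    by (simp add: if_distrib[of "vec_nth (u _)"] fun_upd_def)
  then show ?case by blast
qed

text \<open>
  The cofactors are themselves determinants of the same shape, so that they vary holomorphically
  with the entries.
\<close>

lemma nat_det_col_cofactors:
  assumes "j < k"
  shows "nat_det k (\<lambda>i l. if l = j then b i else A i l) =
    (\<Sum>i<k. b i * nat_det k (\<lambda>m l. if l = j then (if m = i then 1 else 0) else A m l))"
proof -
  obtain C where C: "\<forall>b. nat_det k (\<lambda>i l. if l = j then b i else A i l) = (\<Sum>i<k. b i * C i)"
    using nat_det_col_expand[OF assms, of A] by blast
  have cof: "nat_det k (\<lambda>m l. if l = j then (if m = i then 1 else 0) else A m l) = C i" if "i < k" for i
  proof -
    have "(\<Sum>m<k. (if m = i then 1 else 0) * C m) = (\<Sum>m<k. if m = i then C m else 0)"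
      by (rule sum.cong) auto
    also have "\<dots> = C i" using that by simp
    finally show ?thesis by (subst C[rule_format, of "\<lambda>m. if m = i then 1 else 0"])
  qed
  have "nat_det k (\<lambda>i l. if l = j then b i else A i l) = (\<Sum>i<k. b i * C i)"
    by (rule C[rule_format])
  also have "\<dots> = (\<Sum>i<k. b i * nat_det k (\<lambda>m l. if l = j then (if m = i then 1 else 0) else A m l))"
    by (intro sum.cong refl) (simp only: cof lessThan_iff)
  finally show ?thesis .
qed

lemma nat_det_col_add:
  assumes "j < k"
  shows "nat_det k (\<lambda>i l. if l = j then b i + b' i else A i l) =
    nat_det k (\<lambda>i l. if l = j then b i else A i l) + nat_det k (\<lambda>i l. if l = j then b' i else A i l)"
proof -
  obtain C where C: "\<forall>b. nat_det k (\<lambda>i l. if l = j then b i else A i l) = (\<Sum>i<k. b i * C i)"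
    using nat_det_col_expand[OF assms, of A] by blast
  show ?thesis
    using C[rule_format, of b] C[rule_format, of b'] C[rule_format, of "\<lambda>i. b i + b' i"]
    by (simp add: distrib_right sum.distrib)
qed

lemma nat_det_col_scale:
  assumes "j < k"
  shows "nat_det k (\<lambda>i l. if l = j then s * b i else A i l) =
    s * nat_det k (\<lambda>i l. if l = j then b i else A i l)"
proof -
  obtain C where C: "\<forall>b. nat_det k (\<lambda>i l. if l = j then b i else A i l) = (\<Sum>i<k. b i * C i)"
    using nat_det_col_expand[OF assms, of A] by blast
  show ?thesis
    using C[rule_format, of b] C[rule_format, of "\<lambda>i. s * b i"]
    by (simp add: sum_distrib_left mult.assoc)
qed

section \<open>Determinants of holomorphic functions and of germs\<close>

lemma holomorphic_at_nat_det:
  assumes "\<And>i j. i < k \<Longrightarrow> j < k \<Longrightarrow> holomorphic_at (F i j) p"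
  shows "holomorphic_at (\<lambda>z. nat_det k (\<lambda>i j. F i j z)) p"
  unfolding nat_det_perm_sum
proof (intro holomorphic_at_sum holomorphic_at_mult holomorphic_at_prod holomorphic_at_const assms)
  fix \<pi> i assume "\<pi> \<in> {\<pi>. \<pi> permutes {..<k}}" and i: "i \<in> {..<k}"
  then have "\<pi> permutes {..<k}" by simp
  from permutes_in_image[OF this, of i] i show "\<pi> i < k" by simp
  show "i < k" using i by simp
qed

text \<open>
  By expansion along a column that vanishes at \<open>p\<close>, the product rule leaves only the terms in
  which the entries of this column are differentiated.
\<close>

lemma grad_nat_det_zero_col:
  assumes j: "j < k" and F: "\<And>i l. i < k \<Longrightarrow> l < k \<Longrightarrow> holomorphic_at (F i l) p"
    and zero: "\<And>i. i < k \<Longrightarrow> F i j p = 0"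
  shows "nat_det k (\<lambda>i l. F i l p) = 0"
    and "linform (grad (\<lambda>z. nat_det k (\<lambda>i l. F i l z)) p) v =
      nat_det k (\<lambda>i l. if l = j then linform (grad (F i j) p) v else F i l p)"
proof -
  define C where "C i z = nat_det k (\<lambda>m l. if l = j then (if m = i then 1 else 0) else F m l z)" for i z
  have expand: "nat_det k (\<lambda>i l. F i l z) = (\<Sum>i<k. F i j z * C i z)" for z
  proof -
    have "nat_det k (\<lambda>i l. F i l z) = nat_det k (\<lambda>i l. if l = j then F i j z else F i l z)"
      by (rule nat_det_cong) simp
    also have "\<dots> = (\<Sum>i<k. F i j z * C i z)"
      unfolding C_def by (rule nat_det_col_cofactors[OF j])
    finally show ?thesis .
  qed
  have C: "holomorphic_at (C i) p" for i
  proof -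
    have "holomorphic_at (\<lambda>z. nat_det k (\<lambda>m l. (\<lambda>z. if l = j then (if m = i then 1 else 0) else F m l z) z)) p"
    proof (rule holomorphic_at_nat_det)
      show "holomorphic_at (\<lambda>z. if l = j then (if m = i then 1 else 0) else F m l z) p" if "m < k" "l < k" for m l
        using F[OF that] by (cases "l = j") auto
    qed
    then show ?thesis by (simp add: C_def[abs_def])
  qed
  show "nat_det k (\<lambda>i l. F i l p) = 0" by (simp add: expand zero)
  have "grad (\<lambda>z. nat_det k (\<lambda>i l. F i l z)) p = (\<Sum>i<k. C i p *s grad (F i j) p)"
    unfolding expand using j F C zero
    by (subst grad_sum) (auto simp: grad_mult intro!: holomorphic_at_mult)
  then have "linform (grad (\<lambda>z. nat_det k (\<lambda>i l. F i l z)) p) v = (\<Sum>i<k. linform (grad (F i j) p) v * C i p)"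
    by (simp add: linform_def sum_distrib_left sum_distrib_right mult_ac sum.swap[of _ UNIV])
  also have "\<dots> = nat_det k (\<lambda>i l. if l = j then linform (grad (F i j) p) v else F i l p)"
    unfolding C_def by (rule nat_det_col_cofactors[OF j, symmetric])
  finally show "linform (grad (\<lambda>z. nat_det k (\<lambda>i l. F i l z)) p) v =
      nat_det k (\<lambda>i l. if l = j then linform (grad (F i j) p) v else F i l p)" .
qed

text \<open>
  The operations on germs are pointwise near \<open>p\<close>, so a minor is the germ of an honest
  determinant of functions.
\<close>

lemma ring_det_germ:
  assumes F: "\<And>i j. i < k \<Longrightarrow> j < k \<Longrightarrow> holomorphic_at (F i j) p"
  shows "ring_det (germ_ring p) k (\<lambda>i j. germ p (F i j)) = germ p (\<lambda>z. nat_det k (\<lambda>i j. F i j z))"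
proof -
  interpret cring "germ_ring p" by (rule cring_germ_ring)
  define T where "T \<pi> z = (if evenperm \<pi> then 1 else -1) * (\<Prod>i<k. F i (\<pi> i) z)" for \<pi> z
  have perm: "\<pi> i < k" if "\<pi> permutes {..<k}" "i < k" for \<pi> i
    using permutes_in_image[OF that(1), of i] that(2) by simp
  have prod: "holomorphic_at (\<lambda>z. \<Prod>i<k. F i (\<pi> i) z) p" if "\<pi> permutes {..<k}" for \<pi>
    using F perm[OF that] by (intro holomorphic_at_prod) auto
  have T: "holomorphic_at (T \<pi>) p" if "\<pi> permutes {..<k}" for \<pi>
    unfolding T_def by (intro holomorphic_at_mult holomorphic_at_const prod that)
  have summand: "(if evenperm \<pi> then \<one>\<^bsub>germ_ring p\<^esub> else \<ominus>\<^bsub>germ_ring p\<^esub> \<one>\<^bsub>germ_ring p\<^esub>)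
      \<otimes>\<^bsub>germ_ring p\<^esub> finprod (germ_ring p) (\<lambda>i. germ p (F i (\<pi> i))) {..<k} = germ p (T \<pi>)"
    if "\<pi> permutes {..<k}" for \<pi>
  proof -
    have "finprod (germ_ring p) (\<lambda>i. germ p (F i (\<pi> i))) {..<k} = germ p (\<lambda>z. \<Prod>i<k. F i (\<pi> i) z)"
      using F perm[OF that] by (intro germ_finprod) auto
    then show ?thesis by (simp add: germ_one germ_uminus T_def[abs_def])
  qed
  have "ring_det (germ_ring p) k (\<lambda>i j. germ p (F i j)) =
      finsum (germ_ring p) (\<lambda>\<pi>. germ p (T \<pi>)) {\<pi>. \<pi> permutes {..<k}}"
    unfolding ring_det_def by (rule finsum_cong') (use T summand in auto)
  also have "\<dots> = germ p (\<lambda>z. \<Sum>\<pi> | \<pi> permutes {..<k}. T \<pi> z)"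
    by (rule germ_finsum) (use T in \<open>auto simp: finite_permutations\<close>)
  finally show ?thesis by (simp add: nat_det_perm_sum T_def)
qed

section \<open>Ideals of smooth germs to first order\<close>

lemma vanishing_ideal_germ_iff:
  "germ p f \<in> vanishing_ideal p X \<longleftrightarrow> holomorphic_at f p \<and> (\<forall>\<^sub>F z in nhds p. z \<in> X \<longrightarrow> f z = 0)"
proof -
  have "(\<forall>\<^sub>F z in nhds p. z \<in> X \<longrightarrow> rep (germ p f) z = 0) \<longleftrightarrow> (\<forall>\<^sub>F z in nhds p. z \<in> X \<longrightarrow> f z = 0)"
    by (rule eventually_subst) (use eventually_rep_germ[of p f] in eventually_elim, simp)
  then show ?thesis by (simp add: vanishing_ideal_def)
qed

lemma vanishing_idealE:
  assumes "a \<in> vanishing_ideal p X"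
  obtains f where "a = germ p f" "holomorphic_at f p" "\<forall>\<^sub>F z in nhds p. z \<in> X \<longrightarrow> f z = 0"
proof -
  have "a \<in> carrier (germ_ring p)" using assms by (simp add: vanishing_ideal_def)
  then obtain f where f: "a = germ p f" "holomorphic_at f p" by (rule germ_ringE)
  with assms have "\<forall>\<^sub>F z in nhds p. z \<in> X \<longrightarrow> f z = 0" by (simp add: vanishing_ideal_germ_iff)
  with f show ?thesis by (rule that)
qed

text \<open>
  This makes statements about \<open>M\<^sup>2\<close> instances of statements about \<open>M I(X)\<close>.
\<close>

lemma max_ideal_eq_vanishing_ideal: "max_ideal p = vanishing_ideal p {p}"
proof (rule Set.set_eqI)
  fix a
  have "(\<forall>\<^sub>F z in nhds p. z \<in> {p} \<longrightarrow> h z = 0) \<longleftrightarrow> h p = 0" for h :: "complex^'a \<Rightarrow> complex"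
  proof
    assume "\<forall>\<^sub>F z in nhds p. z \<in> {p} \<longrightarrow> h z = 0"
    from eventually_nhds_x_imp_x[OF this] show "h p = 0" by simp
  qed (simp add: always_eventually)
  then show "a \<in> max_ideal p \<longleftrightarrow> a \<in> vanishing_ideal p {p}"
    by (simp add: max_ideal_def vanishing_ideal_def germ_val_def)
qed

lemma max_ideal_germ_iff: "germ p f \<in> max_ideal p \<longleftrightarrow> holomorphic_at f p \<and> f p = 0"
  by (simp add: max_ideal_def)

lemma ideal_vanishing_ideal: "ideal (vanishing_ideal p X) (germ_ring p)"
proof -
  interpret cring "germ_ring p" by (rule cring_germ_ring)
  show ?thesis
  proof (rule idealI)
    show "subgroup (vanishing_ideal p X) (add_monoid (germ_ring p))"
    proof (rule add.subgroupI)
      show "vanishing_ideal p X \<subseteq> carrier (germ_ring p)" by (auto simp: vanishing_ideal_def)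
      have "germ p (\<lambda>_. 0) \<in> vanishing_ideal p X" by (simp add: vanishing_ideal_germ_iff)
      then show "vanishing_ideal p X \<noteq> {}" by blast
      fix a assume "a \<in> vanishing_ideal p X"
      then obtain f where f: "a = germ p f" "holomorphic_at f p" "\<forall>\<^sub>F z in nhds p. z \<in> X \<longrightarrow> f z = 0"
        by (rule vanishing_idealE)
      then show "\<ominus>\<^bsub>germ_ring p\<^esub> a \<in> vanishing_ideal p X"
        by (simp add: germ_uminus vanishing_ideal_germ_iff holomorphic_at_uminus)
      fix b assume "b \<in> vanishing_ideal p X"
      then obtain g where g: "b = germ p g" "holomorphic_at g p" "\<forall>\<^sub>F z in nhds p. z \<in> X \<longrightarrow> g z = 0"
        by (rule vanishing_idealE)
      have "\<forall>\<^sub>F z in nhds p. z \<in> X \<longrightarrow> f z + g z = 0"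
        using f(3) g(3) by eventually_elim simp
      with f g show "a \<oplus>\<^bsub>germ_ring p\<^esub> b \<in> vanishing_ideal p X"
        by (simp add: vanishing_ideal_germ_iff holomorphic_at_add)
    qed
    fix a x assume "a \<in> vanishing_ideal p X" and x: "x \<in> carrier (germ_ring p)"
    then obtain f where f: "a = germ p f" "holomorphic_at f p" "\<forall>\<^sub>F z in nhds p. z \<in> X \<longrightarrow> f z = 0"
      by (elim vanishing_idealE)
    obtain g where g: "x = germ p g" "holomorphic_at g p"
      using x by (rule germ_ringE)
    have "\<forall>\<^sub>F z in nhds p. z \<in> X \<longrightarrow> g z * f z = 0"
      using f(3) by eventually_elim simp
    then show "x \<otimes>\<^bsub>germ_ring p\<^esub> a \<in> vanishing_ideal p X"
      using f g by (simp add: vanishing_ideal_germ_iff holomorphic_at_mult)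
    then show "a \<otimes>\<^bsub>germ_ring p\<^esub> x \<in> vanishing_ideal p X"
      using f g by (simp add: mult.commute)
  qed (rule ring_axioms)
qed

text \<open>
  A chart, reduced to what concerns germs at \<open>p\<close>: the coordinates outside \<open>S\<close> vanish on
  \<open>X\<close>, and points with these coordinates zero come from \<open>X\<close>.
\<close>

lemma smooth_germ_chart:
  fixes X :: "(complex^'n) set"
  assumes "smooth_germ X p d"
  obtains \<phi> \<psi> :: "complex^'n \<Rightarrow> complex^'n" and S
  where "holomorphic_map_at \<phi> p" "holomorphic_map_at \<psi> (\<phi> p)" "card S = d"
    "\<forall>\<^sub>F z in nhds p. \<psi> (\<phi> z) = z"
    "\<forall>\<^sub>F z in nhds p. z \<in> X \<longrightarrow> (\<forall>i. i \<notin> S \<longrightarrow> \<phi> z $ i = 0)"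
    "\<forall>\<^sub>F w in nhds (\<phi> p). (\<forall>i. i \<notin> S \<longrightarrow> w $ i = 0) \<longrightarrow> \<psi> w \<in> X"
    "\<And>i. i \<notin> S \<Longrightarrow> \<phi> p $ i = 0"
proof -
  from assms obtain U V \<phi> \<psi> and S :: "'n set" where *: "p \<in> X"
    "open U" "open V" "p \<in> U" "homeomorphism U V \<phi> \<psi>"
    "holomorphic_map_on \<phi> U" "holomorphic_map_on \<psi> V"
    "card S = d" "\<phi> ` (X \<inter> U) = {w \<in> V. \<forall>i. i \<notin> S \<longrightarrow> w $ i = 0}"
    unfolding smooth_germ_def by blast
  have inv: "\<And>z. z \<in> U \<Longrightarrow> \<psi> (\<phi> z) = z" and V: "\<And>z. z \<in> U \<Longrightarrow> \<phi> z \<in> V"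
    using *(5) by (auto simp: homeomorphism_def)
  have evU: "\<forall>\<^sub>F z in nhds p. z \<in> U" and evV: "\<forall>\<^sub>F w in nhds (\<phi> p). w \<in> V"
    using *(2-4) V by (auto intro: eventually_nhds_in_open)
  have X: "\<phi> z $ i = 0" if "z \<in> X" "z \<in> U" "i \<notin> S" for z i
    using *(9) that by blast
  have X': "\<psi> w \<in> X" if "w \<in> V" "\<forall>i. i \<notin> S \<longrightarrow> w $ i = 0" for w
  proof -
    have "w \<in> \<phi> ` (X \<inter> U)" using *(9) that by blast
    then show ?thesis using inv by auto
  qed
  show ?thesis
  proof (rule that)
    show "holomorphic_map_at \<phi> p" "holomorphic_map_at \<psi> (\<phi> p)" "card S = d"
      using * V by (auto simp: holomorphic_map_at_iff)
    show "\<forall>\<^sub>F z in nhds p. \<psi> (\<phi> z) = z" using evU by eventually_elim (rule inv)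
    show "\<forall>\<^sub>F z in nhds p. z \<in> X \<longrightarrow> (\<forall>i. i \<notin> S \<longrightarrow> \<phi> z $ i = 0)"
      using evU by eventually_elim (use X in blast)
    show "\<forall>\<^sub>F w in nhds (\<phi> p). (\<forall>i. i \<notin> S \<longrightarrow> w $ i = 0) \<longrightarrow> \<psi> w \<in> X"
      using evV by eventually_elim (use X' in blast)
    show "\<phi> p $ i = 0" if "i \<notin> S" for i using X that * by blast
  qed
qed

lemma smooth_germ_point:
  fixes p :: "complex^'n"
  shows "smooth_germ {p} p 0"
  unfolding smooth_germ_def
proof (intro conjI exI)
  show "homeomorphism UNIV UNIV (\<lambda>z. z - p) (\<lambda>w. w + p)"
    by (auto simp: homeomorphism_def intro!: continuous_intros image_eqI[of _ _ "_ + p"] image_eqI[of _ _ "_ - p"])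
  have *: "holomorphic_fun_on (\<lambda>z :: complex^'n. z $ i + c) U" for i c U
  proof (rule holomorphic_fun_onI)
    show "((\<lambda>z. z $ i + c) has_derivative linform (axis i 1)) (at z)" for z
      using has_derivative_linform_add[OF vec_nth_has_derivative_linform has_derivative_linform_const] by simp
  qed
  show "holomorphic_map_on (\<lambda>z. z - p) UNIV" 
    unfolding holomorphic_map_on_def using *[of _ "- p $ _"] by simp
  show "holomorphic_map_on (\<lambda>z. z + p) UNIV"
    unfolding holomorphic_map_on_def using * by simp
  show "card {} = (0::nat)" by simp
  show "(\<lambda>z. z - p) ` ({p} \<inter> UNIV) = {w \<in> UNIV. \<forall>i. i \<notin> {} \<longrightarrow> w $ i = 0}"
    by (auto simp: vec_eq_iff)
qed auto

lemma holomorphic_map_at_isCont: "holomorphic_map_at F p \<Longrightarrow> isCont F p"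
  using has_derivative_tangent_map has_derivative_continuous unfolding holomorphic_map_at_def by blast

text \<open>
  Elements of \<open>M I\<close> have zero differential by the product rule, both factors being zero at
  \<open>p\<close>.  Conversely, Hadamard's lemma in a chart represents \<open>f \<in> I\<close> by the generators
  \<open>\<phi>\<^sub>j\<close>, \<open>j \<notin> S\<close>, of \<open>I\<close>, with coefficients whose values at \<open>p\<close> are partial derivatives of
  \<open>f\<close> in the chart; these vanish with the differential of \<open>f\<close>, so the coefficients lie in
  \<open>M\<close>.
\<close>

lemma MI_iff_grad_zero:
  fixes X :: "(complex^'n) set"
  assumes smooth: "smooth_germ X p d"
  shows "a \<in> MI p X \<longleftrightarrow> a \<in> vanishing_ideal p X \<and> germ_grad p a = 0"
proof
  interpret cring "germ_ring p" by (rule cring_germ_ring)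
  interpret I: ideal "vanishing_ideal p X" "germ_ring p" by (rule ideal_vanishing_ideal)
  have pX: "p \<in> X" using smooth by (simp add: smooth_germ_def)
  {
    assume "a \<in> MI p X"
    then show "a \<in> vanishing_ideal p X \<and> germ_grad p a = 0"
      unfolding MI_def
    proof (induction rule: ideal_prod.induct)
      case (prod m f)
      obtain m' where m: "m = germ p m'" "holomorphic_at m' p" "m' p = 0"
        using prod(1) unfolding max_ideal_def by (auto elim!: germ_ringE)
      obtain f' where f: "f = germ p f'" "holomorphic_at f' p" "\<forall>\<^sub>F z in nhds p. z \<in> X \<longrightarrow> f' z = 0"
        using prod(2) by (rule vanishing_idealE)
      have "f' p = 0" using eventually_nhds_x_imp_x[OF f(3)] pX by simp
      moreover have "m \<otimes>\<^bsub>germ_ring p\<^esub> f \<in> vanishing_ideal p X"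
        using prod m by (intro I.I_l_closed) simp_all
      ultimately show ?case using m f by (simp add: grad_mult)
    next
      case (sum s1 s2)
      then obtain f where f: "s1 = germ p f" "holomorphic_at f p" by (auto elim: vanishing_idealE)
      obtain g where g: "s2 = germ p g" "holomorphic_at g p" using sum by (auto elim: vanishing_idealE)
      have "s1 \<oplus>\<^bsub>germ_ring p\<^esub> s2 \<in> vanishing_ideal p X"
        using sum.IH by (intro I.a_closed) auto
      then show ?case using f g sum.IH by (simp add: grad_add)
    qed
  }
  assume a: "a \<in> vanishing_ideal p X \<and> germ_grad p a = 0"
  then obtain f where f: "a = germ p f" "holomorphic_at f p" "\<forall>\<^sub>F z in nhds p. z \<in> X \<longrightarrow> f z = 0"
    by (auto elim: vanishing_idealE)
  have grad: "grad f p = 0" using a f by simp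
  obtain \<phi> \<psi> :: "complex^'n \<Rightarrow> complex^'n" and S
    where chart: "holomorphic_map_at \<phi> p" "holomorphic_map_at \<psi> (\<phi> p)" "card S = d"
    "\<forall>\<^sub>F z in nhds p. \<psi> (\<phi> z) = z"
    "\<forall>\<^sub>F z in nhds p. z \<in> X \<longrightarrow> (\<forall>i. i \<notin> S \<longrightarrow> \<phi> z $ i = 0)"
    "\<forall>\<^sub>F w in nhds (\<phi> p). (\<forall>i. i \<notin> S \<longrightarrow> w $ i = 0) \<longrightarrow> \<psi> w \<in> X"
    "\<And>i. i \<notin> S \<Longrightarrow> \<phi> p $ i = 0"
    using smooth_germ_chart[OF smooth] by blast
  define w0 where "w0 = \<phi> p"
  have \<psi>w0: "\<psi> w0 = p" using eventually_nhds_x_imp_x[OF chart(4)] by (simp add: w0_def)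
  have hol: "holomorphic_at (\<lambda>w. f (\<psi> w)) w0"
    and lin: "linform (grad (\<lambda>w. f (\<psi> w)) w0) v = 0" for v
    using holomorphic_at_compose[of f \<psi> w0] chart(2) f(2) grad
    by (simp_all add: w0_def[symmetric] \<psi>w0 holomorphic_map_at_def linform_def)
  have "\<forall>\<^sub>F w in nhds w0. \<psi> w \<in> X \<longrightarrow> f (\<psi> w) = 0"
    by (rule eventually_compose_isCont) (use f(3) chart(2) holomorphic_map_at_isCont in \<open>auto simp: w0_def[symmetric] \<psi>w0\<close>)
  with chart(6) have "\<forall>\<^sub>F w in nhds w0. (\<forall>i. i \<notin> S \<longrightarrow> w $ i = 0) \<longrightarrow> f (\<psi> w) = 0"
    unfolding w0_def by eventually_elim blast
  then obtain U1 where U1: "open U1" "w0 \<in> U1" "\<And>w. w \<in> U1 \<Longrightarrow> (\<forall>i. i \<notin> S \<longrightarrow> w $ i = 0) \<Longrightarrow> f (\<psi> w) = 0"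
    unfolding eventually_nhds by blast
  obtain U2 where U2: "open U2" "w0 \<in> U2" "holomorphic_fun_on (\<lambda>w. f (\<psi> w)) U2"
    using hol unfolding holomorphic_at_def by blast
  have "open (U1 \<inter> U2)" "w0 \<in> U1 \<inter> U2" using U1 U2 by auto
  then obtain r where r: "0 < r" "ball w0 r \<subseteq> U1 \<inter> U2" by (meson openE)
  obtain h where h: "\<And>j. holomorphic_fun_on (h j) (ball w0 r)"
    "\<And>j. h j w0 = partial j (\<lambda>w. f (\<psi> w)) w0"
    "\<And>w. w \<in> ball w0 r \<Longrightarrow> f (\<psi> w) = (\<Sum>j\<in>-S. w $ j * h j w)"
  proof (rule hadamard_coordinate_subspace[of "\<lambda>w. f (\<psi> w)" w0 r S])
    show "holomorphic_fun_on (\<lambda>w. f (\<psi> w)) (ball w0 r)"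
      by (rule holomorphic_fun_on_subset[OF U2(3)]) (use r in auto)
    show "f (\<psi> w) = 0" if "w \<in> ball w0 r" "\<And>j. j \<notin> S \<Longrightarrow> w $ j = 0" for w
      using U1(3)[of w] r that by blast
  qed (use r chart(7) in \<open>auto simp: w0_def\<close>)
  \<comment> \<open>The partial derivatives of \<open>f\<close> in the chart vanish with its differential.\<close>
  have h0: "h j w0 = 0" for j
    using lin[of "axis j 1"] by (simp add: h(2) grad_def)
  have hol_h: "holomorphic_at (h j) w0" for j
    unfolding holomorphic_at_def using h(1) r by (intro exI[of _ "ball w0 r"]) auto
  have hol_h\<phi>: "holomorphic_at (\<lambda>z. h j (\<phi> z)) p" for j
    using holomorphic_at_compose(1)[of "h j" \<phi> p] hol_h chart(1) by (simp add: w0_def holomorphic_map_at_def)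
  have hol_\<phi>: "holomorphic_at (\<lambda>z. \<phi> z $ j) p" for j
    using chart(1) by (simp add: holomorphic_map_at_def)
  have "\<forall>\<^sub>F z in nhds p. \<phi> z \<in> ball w0 r"
    by (rule eventually_compose_isCont[OF eventually_nhds_in_open])
      (use r chart(1) holomorphic_map_at_isCont in \<open>auto simp: w0_def\<close>)
  with chart(4) have "\<forall>\<^sub>F z in nhds p. f z = (\<Sum>j\<in>-S. h j (\<phi> z) * \<phi> z $ j)"
  proof eventually_elim
    case (elim z) then show ?case using h(3)[of "\<phi> z"] by (simp add: mult.commute)
  qed
  then have a: "a = germ p (\<lambda>z. \<Sum>j\<in>-S. h j (\<phi> z) * \<phi> z $ j)"
    unfolding f(1) by (rule germ_cong)
  \<comment> \<open>Transported back to \<open>p\<close>, the representation is a sum of products from \<open>M\<close> and \<open>I\<close>.\<close>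
  have in_I: "germ p (\<lambda>z. \<phi> z $ j) \<in> vanishing_ideal p X" if "j \<notin> S" for j
    unfolding vanishing_ideal_germ_iff
    using hol_\<phi> chart(5) that by (auto elim!: eventually_mono)
  have in_M: "germ p (\<lambda>z. h j (\<phi> z)) \<in> max_ideal p" for j
    using hol_h\<phi> h0 by (simp add: max_ideal_germ_iff w0_def)
  have prod: "germ p (\<lambda>z. h j (\<phi> z) * \<phi> z $ j) \<in> MI p X" if "j \<notin> S" for j
    using ideal_prod.prod[OF in_M in_I[OF that], where R = "germ_ring p"] by (simp add: MI_def)
  have "germ p (\<lambda>z. \<Sum>j\<in>A. h j (\<phi> z) * \<phi> z $ j) \<in> MI p X" if "finite A" "A \<subseteq> -S" for A
    using that
  proof (induction A rule: finite_induct)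
    case empty
    have "germ p (\<lambda>_. 0) \<in> max_ideal p" "germ p (\<lambda>_. 0) \<in> vanishing_ideal p X"
      by (simp_all add: max_ideal_germ_iff vanishing_ideal_germ_iff)
    from ideal_prod.prod[OF this, where R = "germ_ring p"] show ?case by (simp add: MI_def)
  next
    case (insert j A)
    have "germ p (\<lambda>z. h j (\<phi> z) * \<phi> z $ j) \<oplus>\<^bsub>germ_ring p\<^esub> germ p (\<lambda>z. \<Sum>j\<in>A. h j (\<phi> z) * \<phi> z $ j) \<in> MI p X"
      using insert prod unfolding MI_def by (intro ideal_prod.sum) auto
    then show ?case using insert by simp
  qed
  then show "a \<in> MI p X" unfolding a by simp
qed

lemma max_ideal_square_germ_iff:
  "germ p f \<in> max_ideal p \<cdot>\<^bsub>germ_ring p\<^esub> max_ideal p \<longleftrightarrow> holomorphic_at f p \<and> f p = 0 \<and> grad f p = 0"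
  using MI_iff_grad_zero[OF smooth_germ_point, of "germ p f" p]
  by (simp add: MI_def max_ideal_eq_vanishing_ideal[symmetric] max_ideal_germ_iff)

lemma ideal_MI: "ideal (MI p X) (germ_ring p)"
proof -
  interpret cring "germ_ring p" by (rule cring_germ_ring)
  show ?thesis unfolding MI_def max_ideal_eq_vanishing_ideal
    by (intro ideal_prod_is_ideal ideal_vanishing_ideal)
qed

text \<open>
  For a smooth germ \<open>X\<close> this is its tangent space at \<open>p\<close>.
\<close>

definition conormal_kernel :: "complex^'n \<Rightarrow> (complex^'n) set \<Rightarrow> (complex^'n) set" where
  "conormal_kernel p X = {v. \<forall>a\<in>vanishing_ideal p X. linform (germ_grad p a) v = 0}"

lemma subspace_conormal_kernel: "vec.subspace (conormal_kernel p X)"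
  by (auto simp: conormal_kernel_def vec.subspace_def linform_add linform_scale) (simp add: linform_def)

text \<open>
  The differential of the inverse chart maps a \<open>d\<close>-dimensional coordinate subspace onto a space
  that contains the kernel, since the functions \<open>\<phi>\<^sub>j\<close>, \<open>j \<notin> S\<close>, belong to the ideal.
\<close>

lemma dim_conormal_kernel_le:
  fixes X :: "(complex^'n) set"
  assumes smooth: "smooth_germ X p d"
  shows "vec.dim (conormal_kernel p X) \<le> d"
proof -
  obtain \<phi> \<psi> :: "complex^'n \<Rightarrow> complex^'n" and S
    where chart: "holomorphic_map_at \<phi> p" "holomorphic_map_at \<psi> (\<phi> p)" "card S = d"
    "\<forall>\<^sub>F z in nhds p. \<psi> (\<phi> z) = z"
    "\<forall>\<^sub>F z in nhds p. z \<in> X \<longrightarrow> (\<forall>i. i \<notin> S \<longrightarrow> \<phi> z $ i = 0)"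
    using smooth_germ_chart[OF smooth] by blast
  have "tangent_map (\<lambda>z. \<psi> (\<phi> z)) p = tangent_map (\<lambda>z. z) p"
    by (rule tangent_map_cong) (rule chart(4))
  then have inv: "tangent_map \<psi> (\<phi> p) (tangent_map \<phi> p v) = v" for v
    using tangent_map_compose[of \<psi> \<phi> p v] chart by (simp add: holomorphic_map_at_def)
  have zero: "tangent_map \<phi> p v $ i = 0" if "v \<in> conormal_kernel p X" "i \<notin> S" for v i
  proof -
    have "germ p (\<lambda>z. \<phi> z $ i) \<in> vanishing_ideal p X"
      unfolding vanishing_ideal_germ_iff
      using chart(1,5) that by (auto simp: holomorphic_map_at_def elim!: eventually_mono)
    with that show ?thesis by (auto simp: conormal_kernel_def tangent_map_def)
  qed
  have "conormal_kernel p X \<subseteq> tangent_map \<psi> (\<phi> p) ` {w. \<forall>i. i \<notin> S \<longrightarrow> w $ i = 0}"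
  proof
    fix v assume "v \<in> conormal_kernel p X"
    then show "v \<in> tangent_map \<psi> (\<phi> p) ` {w. \<forall>i. i \<notin> S \<longrightarrow> w $ i = 0}"
      using zero by (intro image_eqI[of _ _ "tangent_map \<phi> p v"]) (simp_all add: inv)
  qed
  then have "vec.dim (conormal_kernel p X) \<le> vec.dim (tangent_map \<psi> (\<phi> p) ` {w. \<forall>i. i \<notin> S \<longrightarrow> w $ i = 0})"
    by (rule vec.dim_subset)
  also have "\<dots> \<le> vec.dim {w :: complex^'n. \<forall>i. i \<notin> S \<longrightarrow> w $ i = 0}"
  proof (rule vec.dim_image_le)
    show "Vector_Spaces.linear (*s) (*s) (tangent_map \<psi> (\<phi> p))"
      by unfold_locales (simp_all add: tangent_map_linear)
  qed
  also have "\<dots> = d" using dim_substandard_cart[of S] chart(3) by simp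
  finally show ?thesis .
qed

section \<open>Linear algebra of values and minors\<close>

lemma der_rep:
  assumes "\<xi> \<in> carrier (der_module p)"
  shows "germ p (rep \<xi>) = \<xi>" "holomorphic_map_at (rep \<xi>) p"
    "linear_part p \<xi> = tangent_map (rep \<xi>) p"
proof -
  obtain F where F: "\<xi> = germ p F" "holomorphic_map_at F p" using assms by (rule der_moduleE)
  show 1: "germ p (rep \<xi>) = \<xi>" by (simp add: F germ_rep_germ)
  show 2: "holomorphic_map_at (rep \<xi>) p" using assms germ_in_der_iff[of p "rep \<xi>"] 1 by simp
  show "linear_part p \<xi> = tangent_map (rep \<xi>) p" using linear_part_germ[OF 2] 1 by simp
qed

lemma der_uminus:
  assumes "holomorphic_map_at F p"
  shows "\<ominus>\<^bsub>der_module p\<^esub> germ p F = germ p (\<lambda>z. - F z)"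
proof -
  interpret module "germ_ring p" "der_module p" by (rule module_der)
  show ?thesis
    by (rule M.minus_equality) (simp_all add: assms holomorphic_map_at_intros der_zero)
qed

lemma minor_germ:
  assumes "\<And>j. j < k \<Longrightarrow> c j \<in> carrier (der_module p)"
  shows "ring_det (germ_ring p) k (\<lambda>i j. coefficient p (c j) (r i)) =
      germ p (\<lambda>z. nat_det k (\<lambda>i j. rep (c j) z $ r i))"
    and "holomorphic_at (\<lambda>z. nat_det k (\<lambda>i j. rep (c j) z $ r i)) p"
proof -
  have "holomorphic_at (\<lambda>z. rep (c j) z $ r i) p" if "j < k" for i j
    using der_rep(2)[OF assms[OF that]] by (simp add: holomorphic_map_at_def)
  then show "ring_det (germ_ring p) k (\<lambda>i j. coefficient p (c j) (r i)) =
      germ p (\<lambda>z. nat_det k (\<lambda>i j. rep (c j) z $ r i))"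
    "holomorphic_at (\<lambda>z. nat_det k (\<lambda>i j. rep (c j) z $ r i)) p"
    unfolding coefficient_def by (auto intro!: ring_det_germ holomorphic_at_nat_det)
qed

text \<open>
  Determinants speak of families of columns, the dimension of a space of independent sets.
\<close>

lemma independent_family_iff:
  fixes u :: "nat \<Rightarrow> complex^'n"
  shows "(\<forall>x. (\<Sum>j<k. x j *s u j) = 0 \<longrightarrow> (\<forall>j<k. x j = 0)) \<longleftrightarrow>
    inj_on u {..<k} \<and> vec.independent (u ` {..<k})" (is "?lhs \<longleftrightarrow> ?rhs")
proof
  assume lhs: ?lhs
  have inj: "inj_on u {..<k}"
  proof (rule inj_onI, rule ccontr)
    fix j l assume jl: "j \<in> {..<k}" "l \<in> {..<k}" "u j = u l" "j \<noteq> l"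
    define x where "x m = (if m = j then 1 else if m = l then -1 else 0 :: complex)" for m
    have "(\<Sum>m<k. x m *s u m) = (\<Sum>m\<in>{j, l}. x m *s u m)"
      by (rule sum.mono_neutral_right) (use jl in \<open>auto simp: x_def\<close>)
    also have "\<dots> = 0" using jl by (simp add: x_def)
    finally show False using lhs jl by (force simp: x_def)
  qed
  have "\<not> vec.dependent (u ` {..<k})"
  proof
    assume "vec.dependent (u ` {..<k})"
    then obtain y where y: "\<exists>v\<in>u ` {..<k}. y v \<noteq> 0" "(\<Sum>v\<in>u ` {..<k}. y v *s v) = 0"
      by (subst (asm) vec.dependent_finite) auto
    from y(2) have "(\<Sum>j<k. y (u j) *s u j) = 0" by (simp add: sum.reindex[OF inj])
    with lhs y(1) show False by auto
  qed
  with inj show ?rhs by simp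
next
  assume rhs: ?rhs
  show ?lhs
  proof (intro allI impI)
    fix x j assume x: "(\<Sum>j<k. x j *s u j) = 0" and j: "j < k"
    define y where "y v = x (the_inv_into {..<k} u v)" for v
    have y: "y (u i) = x i" if "i < k" for i
      using the_inv_into_f_f[of u "{..<k}" i] rhs that by (simp add: y_def)
    have "(\<Sum>v\<in>u ` {..<k}. y v *s v) = (\<Sum>j<k. x j *s u j)"
      using rhs by (simp add: sum.reindex y)
    then have "y (u j) = 0"
      using vec.independentD[of "u ` {..<k}" "u ` {..<k}" y "u j"] rhs x j by simp
    then show "x j = 0" using y j by simp
  qed
qed

lemma independent_card_le_dim_family:
  fixes u :: "nat \<Rightarrow> complex^'n"
  assumes "\<forall>x. (\<Sum>j<k. x j *s u j) = 0 \<longrightarrow> (\<forall>j<k. x j = 0)" "A \<subseteq> {..<k}" "u ` A \<subseteq> W"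
  shows "card A \<le> vec.dim W"
proof -
  have inj: "inj_on u {..<k}" and ind: "vec.independent (u ` {..<k})"
    using independent_family_iff[where k = k and u = u] assms(1) by auto
  have "vec.independent (u ` A)"
    by (rule vec.independent_mono[OF ind]) (use assms in auto)
  from vec.independent_card_le_dim[OF assms(3) this] show ?thesis
    using card_image[OF inj_on_subset[OF inj assms(2)]] by simp
qed

section \<open>Submodules of logarithmic vector fields\<close>

locale logarithmic_submodule =
  fixes X :: "(complex^'n) set" and p :: "complex^'n" and d :: nat
    and L :: "('n, complex^'n) germ set"
  assumes smooth: "smooth_germ X p d"
    and submodule: "submodule L (germ_ring p) (der_module p)"
    and logarithmic: "L \<subseteq> der_log p X"
begin

lemma L_carrier: "L \<subseteq> carrier (der_module p)"
  using logarithmic by (auto simp: der_log_def)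

lemma L_add: "\<xi> \<in> L \<Longrightarrow> \<eta> \<in> L \<Longrightarrow> \<xi> \<oplus>\<^bsub>der_module p\<^esub> \<eta> \<in> L"
  using module.submoduleE(5)[OF module_der submodule] by blast

lemma L_smult: "a \<in> carrier (germ_ring p) \<Longrightarrow> \<xi> \<in> L \<Longrightarrow> a \<odot>\<^bsub>der_module p\<^esub> \<xi> \<in> L"
  using module.submoduleE(4)[OF module_der submodule] by blast

lemma L_lincomb:
  assumes "finite A" "\<And>j. j \<in> A \<Longrightarrow> c j \<in> L"
  shows "germ p (\<lambda>z. \<Sum>j\<in>A. x j *s rep (c j) z) \<in> L"
  using assms
proof (induction A rule: finite_induct)
  case empty
  obtain \<xi> where \<xi>: "\<xi> \<in> L" using module.submoduleE(2)[OF module_der submodule] by blast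
  then have "germ p (\<lambda>_. 0) \<odot>\<^bsub>der_module p\<^esub> germ p (rep \<xi>) \<in> L"
    using L_carrier by (intro L_smult) (auto simp: der_rep)
  then show ?case by simp
next
  case (insert j A)
  have "germ p (\<lambda>_. x j) \<odot>\<^bsub>der_module p\<^esub> germ p (rep (c j)) \<oplus>\<^bsub>der_module p\<^esub>
      germ p (\<lambda>z. \<Sum>j\<in>A. x j *s rep (c j) z) \<in> L"
    using insert L_carrier by (intro L_add L_smult) (auto simp: der_rep subsetD)
  then show ?case using insert by simp
qed

lemma subspace_eval_space: "vec.subspace (eval_space p L)"
  unfolding vec.subspace_def eval_space_def
proof (intro conjI ballI allI)
  have "germ_val p (germ p (\<lambda>z. \<Sum>j\<in>({} :: nat set). 0 *s rep undefined z)) \<in> germ_val p ` L"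
    by (intro imageI L_lincomb) auto
  then show "0 \<in> germ_val p ` L" by simp
next
  fix v w assume "v \<in> germ_val p ` L" "w \<in> germ_val p ` L"
  then obtain \<xi> \<eta> where *: "\<xi> \<in> L" "\<eta> \<in> L" "v = germ_val p \<xi>" "w = germ_val p \<eta>" by blast
  have "germ p (rep \<xi>) \<oplus>\<^bsub>der_module p\<^esub> germ p (rep \<eta>) \<in> L"
    using * L_carrier by (auto simp: der_rep subsetD intro!: L_add)
  from imageI[OF this, of "germ_val p"] show "v + w \<in> germ_val p ` L"
    by (simp add: *) (simp add: germ_val_def)
next
  fix c v assume "v \<in> germ_val p ` L"
  then obtain \<xi> where *: "\<xi> \<in> L" "v = germ_val p \<xi>" by blast
  have "germ p (\<lambda>_. c) \<odot>\<^bsub>der_module p\<^esub> germ p (rep \<xi>) \<in> L"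
    using * L_carrier by (auto simp: der_rep subsetD intro!: L_smult)
  from imageI[OF this, of "germ_val p"] show "c *s v \<in> germ_val p ` L"
    by (simp add: *) (simp add: germ_val_def)
qed

text \<open>
  For \<open>\<xi> \<in> L\<close> and \<open>f \<in> I\<close>, the germ \<open>\<xi>(f) \<in> I\<close> vanishes at \<open>p\<close>, and its value there is the
  differential of \<open>f\<close> at \<open>\<xi>(p)\<close>.
\<close>

lemma eval_space_subset: "eval_space p L \<subseteq> conormal_kernel p X"
proof
  fix w assume "w \<in> eval_space p L"
  then obtain \<xi> where \<xi>: "\<xi> \<in> L" "w = germ_val p \<xi>" by (auto simp: eval_space_def)
  show "w \<in> conormal_kernel p X"
    unfolding conormal_kernel_def mem_Collect_eq
  proof
    fix a assume a: "a \<in> vanishing_ideal p X"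
    then have "der_apply p \<xi> a \<in> vanishing_ideal p X" using \<xi> logarithmic by (auto simp: der_log_def)
    then obtain g where g: "der_apply p \<xi> a = germ p g" "\<forall>\<^sub>F z in nhds p. z \<in> X \<longrightarrow> g z = 0"
      by (auto elim: vanishing_idealE)
    have "germ_val p (der_apply p \<xi> a) = 0"
      using eventually_nhds_x_imp_x[OF g(2)] smooth by (simp add: g smooth_germ_def)
    moreover obtain f where "a = germ p f" using a by (auto elim: vanishing_idealE)
    moreover have "\<xi> = germ p (rep \<xi>)" using \<xi> L_carrier by (auto simp: der_rep)
    ultimately have "(\<Sum>i\<in>UNIV. rep \<xi> p $ i * partial i f p) = 0" and "a = germ p f"
      using der_apply_germ[of p "rep \<xi>" f] by simp_all
    then show "linform (germ_grad p a) w = 0"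
      by (simp add: linform_def grad_def \<xi>(2) germ_val_def mult.commute)
  qed
qed

lemma dim_eval_space_le: "vec.dim (eval_space p L) \<le> d"
  using vec.dim_subset[OF eval_space_subset] dim_conormal_kernel_le[OF smooth] by simp

lemma eval_space_eq:
  assumes "vec.dim (eval_space p L) = d"
  shows "eval_space p L = conormal_kernel p X"
  by (rule vec.subspace_dim_equal[OF subspace_eval_space subspace_conormal_kernel eval_space_subset])
    (simp add: assms dim_conormal_kernel_le[OF smooth])

text \<open>
  In the derivative of \<open>\<Sum> \<xi>\<^sub>i \<partial>f/\<partial>z\<^sub>i\<close> the terms with second derivatives of \<open>f\<close> carry a factor
  \<open>\<xi>\<^sub>i(p) = 0\<close>.
\<close>

lemma grad_der_apply:
  assumes \<xi>: "\<xi> \<in> vanishing_fields p L" and a: "a \<in> carrier (germ_ring p)"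
  shows "linform (germ_grad p (der_apply p \<xi> a)) v = linform (germ_grad p a) (linear_part p \<xi> v)"
proof -
  have \<xi>L: "\<xi> \<in> carrier (der_module p)" using \<xi> L_carrier by (auto simp: vanishing_fields_def)
  define F where "F = rep \<xi>"
  have F: "\<xi> = germ p F" "holomorphic_map_at F p" "linear_part p \<xi> = tangent_map F p"
    using der_rep[OF \<xi>L] by (simp_all add: F_def)
  have F0: "F p = 0" using \<xi> by (simp add: vanishing_fields_def germ_val_def F_def)
  obtain f where f: "a = germ p f" "holomorphic_at f p" using a by (rule germ_ringE)
  have "grad (\<lambda>z. \<Sum>i\<in>UNIV. F z $ i * partial i f z) p = (\<Sum>i\<in>UNIV. partial i f p *s grad (\<lambda>z. F z $ i) p)"
    using F(2) f(2) F0
    by (subst grad_sum)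
      (auto simp: grad_mult holomorphic_map_at_def holomorphic_at_partial intro!: holomorphic_at_mult)
  also have "\<dots> = (\<chi> i. \<Sum>k\<in>UNIV. grad f p $ k * grad (\<lambda>z. F z $ k) p $ i)"
    by (simp add: vec_eq_iff grad_def[of f])
  finally have "germ_grad p (der_apply p (germ p F) a) = (\<chi> i. \<Sum>k\<in>UNIV. grad f p $ k * grad (\<lambda>z. F z $ k) p $ i)"
    by (simp add: f(1))
  then show ?thesis
    by (simp only: F(3) F(1)[symmetric] f(1) germ_grad_germ linform_tangent_map)
qed

lemma der_apply_mem_MI_iff:
  assumes \<xi>: "\<xi> \<in> vanishing_fields p L" and a: "a \<in> vanishing_ideal p X"
  shows "der_apply p \<xi> a \<in> MI p X \<longleftrightarrow> (\<forall>v. linform (germ_grad p a) (linear_part p \<xi> v) = 0)"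
proof -
  have "der_apply p \<xi> a \<in> vanishing_ideal p X"
    using \<xi> a logarithmic by (auto simp: vanishing_fields_def der_log_def)
  moreover have ac: "a \<in> carrier (germ_ring p)" using a by (simp add: vanishing_ideal_def)
  moreover have "germ_grad p b = 0 \<longleftrightarrow> (\<forall>v. linform (germ_grad p b) v = 0)" for b
  proof
    assume "\<forall>v. linform (germ_grad p b) v = 0"
    then have "linform (germ_grad p b) (axis i 1) = 0" for i by blast
    then show "germ_grad p b = 0" by (simp add: vec_eq_iff)
  qed (simp add: linform_def)
  ultimately show ?thesis using MI_iff_grad_zero[OF smooth] grad_der_apply[OF \<xi> ac] by simp
qed

text \<open>
  The endomorphism is well defined because \<open>\<xi>\<close> maps \<open>M I\<close> into itself: by
  \<open>der_apply_mem_MI_iff\<close> it maps elements of \<open>I\<close> with zero differential into \<open>M I\<close>.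
\<close>

lemma alpha_nonzero_iff:
  assumes \<xi>: "\<xi> \<in> vanishing_fields p L"
  shows "alpha p X \<xi> \<noteq> zero_conormal p X \<longleftrightarrow> (\<exists>a\<in>vanishing_ideal p X. der_apply p \<xi> a \<notin> MI p X)"
proof -
  interpret cring "germ_ring p" by (rule cring_germ_ring)
  interpret I: ideal "vanishing_ideal p X" "germ_ring p" by (rule ideal_vanishing_ideal)
  interpret MI: ideal "MI p X" "germ_ring p" by (rule ideal_MI)
  have conormal: "conormal p X = (\<lambda>a. MI p X +>\<^bsub>germ_ring p\<^esub> a) ` vanishing_ideal p X"
    by (auto simp: conormal_def A_FactGroup_def FactGroup_def RCOSETS_def a_r_coset_def r_coset_def)
  have log: "der_apply p \<xi> a \<in> vanishing_ideal p X" if "a \<in> vanishing_ideal p X" for a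
    using \<xi> that logarithmic by (auto simp: vanishing_fields_def der_log_def)
  have "\<xi> \<in> carrier (der_module p)" using \<xi> L_carrier by (auto simp: vanishing_fields_def)
  then obtain F where F: "\<xi> = germ p F" by (rule der_moduleE)
  have der_add: "der_apply p \<xi> (a \<oplus>\<^bsub>germ_ring p\<^esub> b) = der_apply p \<xi> a \<oplus>\<^bsub>germ_ring p\<^esub> der_apply p \<xi> b"
    if a: "a \<in> vanishing_ideal p X" and b: "b \<in> vanishing_ideal p X" for a b
  proof -
    obtain f where f: "a = germ p f" "holomorphic_at f p" using a by (auto elim: vanishing_idealE)
    obtain g where g: "b = germ p g" "holomorphic_at g p" using b by (auto elim: vanishing_idealE)
    have "\<forall>\<^sub>F z in nhds p. \<forall>i. partial i (\<lambda>z. f z + g z) z = partial i f z + partial i g z"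
      using eventually_has_derivative_grad[OF f(2)] eventually_has_derivative_grad[OF g(2)]
    proof eventually_elim
      case (elim z)
      have "grad (\<lambda>z. f z + g z) z = grad f z + grad g z"
        by (rule has_derivative_linform_unique(2)) (rule has_derivative_linform_add[OF elim])
      then show ?case by (simp add: grad_def vec_eq_iff)
    qed
    then show ?thesis unfolding F f g
      by (simp, intro germ_cong) (erule eventually_mono, simp add: distrib_left sum.distrib)
  qed
  have MI_sub: "MI p X \<subseteq> vanishing_ideal p X" using MI_iff_grad_zero[OF smooth] by blast
  have der_MI: "der_apply p \<xi> m \<in> MI p X" if "m \<in> MI p X" for m
  proof -
    have "m \<in> vanishing_ideal p X" "germ_grad p m = 0" using that MI_iff_grad_zero[OF smooth] by auto
    then show ?thesis by (subst der_apply_mem_MI_iff[OF \<xi>]) (auto simp: linform_def)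
  qed
  have coset: "the_elem ((\<lambda>b. MI p X +>\<^bsub>germ_ring p\<^esub> der_apply p \<xi> b) ` (MI p X +>\<^bsub>germ_ring p\<^esub> a)) =
      MI p X +>\<^bsub>germ_ring p\<^esub> der_apply p \<xi> a" if a: "a \<in> vanishing_ideal p X" for a
  proof -
    have "MI p X +>\<^bsub>germ_ring p\<^esub> der_apply p \<xi> b = MI p X +>\<^bsub>germ_ring p\<^esub> der_apply p \<xi> a"
      if b: "b \<in> MI p X +>\<^bsub>germ_ring p\<^esub> a" for b
    proof -
      obtain m where m: "m \<in> MI p X" "b = m \<oplus>\<^bsub>germ_ring p\<^esub> a"
        using b by (auto simp: a_r_coset_def r_coset_def)
      have "der_apply p \<xi> b = der_apply p \<xi> m \<oplus>\<^bsub>germ_ring p\<^esub> der_apply p \<xi> a"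
        using m a MI_sub by (simp add: der_add subsetD)
      then have "der_apply p \<xi> b \<in> MI p X +>\<^bsub>germ_ring p\<^esub> der_apply p \<xi> a"
        using der_MI[OF m(1)] by (auto simp: a_r_coset_def r_coset_def)
      then show ?thesis
        using a_repr_independence[of "der_apply p \<xi> b" "MI p X" "der_apply p \<xi> a"] log[OF a] I.Icarr MI.a_subgroup
        by simp
    qed
    moreover have "a \<in> MI p X +>\<^bsub>germ_ring p\<^esub> a"
    proof -
      have "\<zero>\<^bsub>germ_ring p\<^esub> \<oplus>\<^bsub>germ_ring p\<^esub> a \<in> MI p X +>\<^bsub>germ_ring p\<^esub> a"
        unfolding a_r_coset_def' using MI.zero_closed by blast
      then show ?thesis using I.Icarr[OF a] by simp
    qed
    ultimately have "(\<lambda>b. MI p X +>\<^bsub>germ_ring p\<^esub> der_apply p \<xi> b) ` (MI p X +>\<^bsub>germ_ring p\<^esub> a) =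
        {MI p X +>\<^bsub>germ_ring p\<^esub> der_apply p \<xi> a}" by blast
    then show ?thesis by simp
  qed
  have "alpha p X \<xi> = zero_conormal p X \<longleftrightarrow>
      (\<forall>C\<in>conormal p X. the_elem ((\<lambda>b. MI p X +>\<^bsub>germ_ring p\<^esub> der_apply p \<xi> b) ` C) = MI p X)"
    unfolding alpha_def zero_conormal_def by (auto simp: fun_eq_iff restrict_def)
  also have "\<dots> \<longleftrightarrow> (\<forall>a\<in>vanishing_ideal p X. MI p X +>\<^bsub>germ_ring p\<^esub> der_apply p \<xi> a = MI p X)"
    by (simp add: conormal coset)
  also have "\<dots> \<longleftrightarrow> (\<forall>a\<in>vanishing_ideal p X. der_apply p \<xi> a \<in> MI p X)"
  proof (rule ball_cong[OF refl])
    fix a assume "a \<in> vanishing_ideal p X"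
    then have "der_apply p \<xi> a \<in> carrier (germ_ring p)" by (intro I.Icarr log)
    from a_coset_join1[OF _ this MI.a_subgroup] a_coset_join2[OF this MI.a_subgroup]
    show "MI p X +>\<^bsub>germ_ring p\<^esub> der_apply p \<xi> a = MI p X \<longleftrightarrow> der_apply p \<xi> a \<in> MI p X"
      by (rule iffI)
  qed
  finally show ?thesis by blast
qed

text \<open>
  Here \<open>W = T\<close>, and the linear part of \<open>\<xi>\<close> preserves \<open>T\<close>: the differential of \<open>f \<in> I\<close> at the
  image of \<open>w\<close> is that of \<open>\<xi>(f) \<in> I\<close> at \<open>w\<close>.
\<close>

lemma beta_nonzero_iff:
  assumes dim: "vec.dim (eval_space p L) = d" and \<xi>: "\<xi> \<in> vanishing_fields p L"
  shows "beta p L \<xi> \<noteq> zero_normal p L \<longleftrightarrow> (\<exists>v. linear_part p \<xi> v \<notin> eval_space p L)"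
proof -
  define W where "W = eval_space p L"
  have W: "vec.subspace W" using subspace_eval_space by (simp add: W_def)
  have \<xi>c: "\<xi> \<in> carrier (der_module p)" using \<xi> L_carrier by (auto simp: vanishing_fields_def)
  have lin: "linear_part p \<xi> (v + w) = linear_part p \<xi> v + linear_part p \<xi> w" for v w
    by (simp add: der_rep[OF \<xi>c] tangent_map_linear)
  have coset_eq: "v +o W = w +o W \<longleftrightarrow> v - w \<in> W" for v w
  proof
    assume "v +o W = w +o W"
    moreover have "v \<in> v +o W" using vec.subspace_0[OF W] by (force simp: elt_set_plus_def)
    ultimately show "v - w \<in> W" by (auto simp: elt_set_plus_def)
  next
    assume vw: "v - w \<in> W"
    show "v +o W = w +o W"
    proof (rule Set.set_eqI)
      fix x
      have "x - v \<in> W \<longleftrightarrow> x - w \<in> W"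
        using vec.subspace_add[OF W vw, of "x - v"] vec.subspace_diff[OF W _ vw, of "x - w"] by auto
      moreover have "x \<in> y +o W \<longleftrightarrow> x - y \<in> W" for y
        by (force simp: elt_set_plus_def)
      ultimately show "x \<in> v +o W \<longleftrightarrow> x \<in> w +o W" by simp
    qed
  qed
  have stable: "linear_part p \<xi> w \<in> W" if "w \<in> W" for w
    unfolding W_def eval_space_eq[OF dim] conormal_kernel_def mem_Collect_eq
  proof
    fix a assume a: "a \<in> vanishing_ideal p X"
    then have ac: "a \<in> carrier (germ_ring p)" by (simp add: vanishing_ideal_def)
    have "der_apply p \<xi> a \<in> vanishing_ideal p X"
      using \<xi> a logarithmic by (auto simp: vanishing_fields_def der_log_def)
    with that have "linform (germ_grad p (der_apply p \<xi> a)) w = 0"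
      by (auto simp: W_def eval_space_eq[OF dim] conormal_kernel_def)
    then show "linform (germ_grad p a) (linear_part p \<xi> w) = 0"
      using grad_der_apply[OF \<xi> ac] by simp
  qed
  have coset: "the_elem ((\<lambda>v. linear_part p \<xi> v +o W) ` (v +o W)) = linear_part p \<xi> v +o W" for v
  proof -
    have "linear_part p \<xi> u +o W = linear_part p \<xi> v +o W" if u: "u \<in> v +o W" for u
    proof -
      obtain w where w: "w \<in> W" "u = v + w" using u by (auto simp: elt_set_plus_def)
      show ?thesis unfolding coset_eq by (simp add: w lin stable)
    qed
    moreover have "v \<in> v +o W" using vec.subspace_0[OF W] by (force simp: elt_set_plus_def)
    ultimately have "(\<lambda>v. linear_part p \<xi> v +o W) ` (v +o W) = {linear_part p \<xi> v +o W}" by blast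
    then show ?thesis by simp
  qed
  have "beta p L \<xi> = zero_normal p L \<longleftrightarrow>
      (\<forall>C\<in>normal_space p L. the_elem ((\<lambda>v. linear_part p \<xi> v +o W) ` C) = W)"
    unfolding beta_def zero_normal_def W_def by (auto simp: fun_eq_iff restrict_def)
  also have "\<dots> \<longleftrightarrow> (\<forall>v. linear_part p \<xi> v +o W = 0 +o W)"
    by (simp add: normal_space_def coset W_def[symmetric])
  also have "\<dots> \<longleftrightarrow> (\<forall>v. linear_part p \<xi> v \<in> W)"
    unfolding coset_eq by simp
  finally show ?thesis by (simp add: W_def)
qed

lemma alpha_nonzero_iff_beta_nonzero:
  assumes dim: "vec.dim (eval_space p L) = d" and \<xi>: "\<xi> \<in> vanishing_fields p L"
  shows "alpha p X \<xi> \<noteq> zero_conormal p X \<longleftrightarrow> beta p L \<xi> \<noteq> zero_normal p L"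
  unfolding alpha_nonzero_iff[OF \<xi>] beta_nonzero_iff[OF dim \<xi>] eval_space_eq[OF dim] conormal_kernel_def
  using der_apply_mem_MI_iff[OF \<xi>] by auto

text \<open>
  From a minor outside \<open>M\<^sup>2\<close> to a field whose linear part leaves \<open>W\<close>: the \<open>d + 1\<close> values of the
  fields are dependent, and Cramer's rule puts a combination that vanishes at \<open>p\<close> in place of one
  of the columns.
\<close>

lemma normal_direction_of_minor:
  assumes c: "\<And>j. j < Suc d \<Longrightarrow> c j \<in> L"
    and minor: "germ p (\<lambda>z. nat_det (Suc d) (\<lambda>i j. rep (c j) z $ r i))
      \<notin> max_ideal p \<cdot>\<^bsub>germ_ring p\<^esub> max_ideal p"
  shows "vec.dim (eval_space p L) = d \<and>
    (\<exists>\<xi>\<in>vanishing_fields p L. \<exists>v. linear_part p \<xi> v \<notin> eval_space p L)"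
proof -
  define u where "u j = germ_val p (c j)" for j
  define f where "f z = nat_det (Suc d) (\<lambda>i j. rep (c j) z $ r i)" for z
  have cc: "c j \<in> carrier (der_module p)" if "j < Suc d" for j using c[OF that] L_carrier by blast
  have hol_c: "holomorphic_at (\<lambda>z. rep (c j) z $ r i) p" if "j < Suc d" for i j
    using der_rep(2)[OF cc[OF that]] by (simp add: holomorphic_map_at_def)
  have hol_f: "holomorphic_at f p"
    using minor_germ(2)[of "Suc d" c p r] cc by (simp add: f_def[abs_def])
  have uW: "u j \<in> eval_space p L" if "j < Suc d" for j
    using c[OF that] by (simp add: u_def eval_space_def)
  have "\<not> (\<forall>x. (\<Sum>j<Suc d. x j *s u j) = 0 \<longrightarrow> (\<forall>j<Suc d. x j = 0))"
  proof
    assume "\<forall>x. (\<Sum>j<Suc d. x j *s u j) = 0 \<longrightarrow> (\<forall>j<Suc d. x j = 0)"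
    then have "card {..<Suc d} \<le> vec.dim (eval_space p L)"
      by (rule independent_card_le_dim_family) (use uW in auto)
    then show False using dim_eval_space_le by simp
  qed
  then obtain x j0 where x: "(\<Sum>j<Suc d. x j *s u j) = 0" and j0: "j0 < Suc d" "x j0 \<noteq> 0"
    by blast
  \<comment> \<open>A combination of the fields that vanishes at \<open>p\<close> and involves the field number \<open>j0\<close>.\<close>
  define \<Xi> where "\<Xi> z = (\<Sum>j<Suc d. x j *s rep (c j) z)" for z
  have \<Xi>L: "germ p \<Xi> \<in> L" unfolding \<Xi>_def[abs_def] using c by (intro L_lincomb) auto
  have \<Xi>0: "\<Xi> p = 0" using x by (simp add: \<Xi>_def u_def germ_val_def)
  have hol_\<Xi>: "holomorphic_map_at \<Xi> p" using \<Xi>L L_carrier by auto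
  have \<Xi>van: "germ p \<Xi> \<in> vanishing_fields p L" using \<Xi>L \<Xi>0 by (simp add: vanishing_fields_def)
  define F where "F i l z = (if l = j0 then \<Xi> z $ r i else rep (c l) z $ r i)" for i l z
  have hol_F: "holomorphic_at (F i l) p" if "l < Suc d" for i l
    using hol_\<Xi> hol_c[OF that] by (cases "l = j0") (simp_all add: F_def[abs_def] holomorphic_map_at_def)
  have F_f: "nat_det (Suc d) (\<lambda>i l. F i l z) = x j0 * f z" for z
    unfolding f_def nat_det_replace_col[OF j0(1), of x "\<lambda>i j. rep (c j) z $ r i", symmetric]
    by (rule nat_det_cong) (simp add: F_def \<Xi>_def)
  have F0: "F i j0 p = 0" for i by (simp add: F_def \<Xi>0)
  have "nat_det (Suc d) (\<lambda>i l. F i l p) = 0"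
    by (rule grad_nat_det_zero_col(1)[OF j0(1)]) (simp_all add: hol_F F0)
  then have "f p = 0" using F_f[of p] j0 by simp
  then have "grad f p \<noteq> 0"
    using minor hol_f by (simp add: max_ideal_square_germ_iff f_def[symmetric, abs_def])
  then obtain i where "grad f p $ i \<noteq> 0" by (auto simp: vec_eq_iff)
  then have "linform (grad f p) (axis i 1) \<noteq> 0" by simp
  then obtain v where v: "linform (grad f p) v \<noteq> 0" by blast
  \<comment> \<open>The columns of the determinant that is the derivative of the minor in direction \<open>v\<close>.\<close>
  define u' where "u' l = (if l = j0 then tangent_map \<Xi> p v else u l)" for l
  have "grad (\<lambda>z. x j0 * f z) p = x j0 *s grad f p"
    using grad_mult[of "\<lambda>_. x j0" p f] hol_f by simp
  then have "x j0 * linform (grad f p) v = linform (grad (\<lambda>z. nat_det (Suc d) (\<lambda>i l. F i l z)) p) v"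
    unfolding F_f by (simp add: linform_def sum_distrib_left mult.assoc)
  also have "\<dots> = nat_det (Suc d) (\<lambda>i l. if l = j0 then linform (grad (F i j0) p) v else F i l p)"
    by (rule grad_nat_det_zero_col(2)[OF j0(1)]) (simp_all add: hol_F F0)
  also have "\<dots> = nat_det (Suc d) (\<lambda>i l. u' l $ r i)"
    by (rule nat_det_cong) (simp add: F_def[abs_def] u'_def u_def tangent_map_def germ_val_def)
  finally have det: "nat_det (Suc d) (\<lambda>i l. u' l $ r i) \<noteq> 0" using v j0 by auto
  have indep: "\<forall>y. (\<Sum>l<Suc d. y l *s u' l) = 0 \<longrightarrow> (\<forall>l<Suc d. y l = 0)"
  proof (intro allI impI, rule ccontr)
    fix y l assume y: "(\<Sum>l<Suc d. y l *s u' l) = 0" and l: "l < Suc d" "y l \<noteq> 0"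
    have "(\<Sum>l<Suc d. y l * (u' l $ r i)) = (\<Sum>l<Suc d. y l *s u' l) $ r i" for i
      by simp
    then have "(\<Sum>l<Suc d. y l * (u' l $ r i)) = 0" for i unfolding y by simp
    from nat_det_dependent_cols[OF this l] det show False by simp
  qed
  \<comment> \<open>Without column \<open>j0\<close> the independent columns lie in \<open>W\<close>; with it they are too many for \<open>W\<close>.\<close>
  have "card ({..<Suc d} - {j0}) \<le> vec.dim (eval_space p L)"
    by (rule independent_card_le_dim_family[OF indep]) (use uW in \<open>auto simp: u'_def\<close>)
  then have dim: "vec.dim (eval_space p L) = d" using dim_eval_space_le j0 by simp
  have "tangent_map \<Xi> p v \<notin> eval_space p L"
  proof
    assume "tangent_map \<Xi> p v \<in> eval_space p L"
    then have "card {..<Suc d} \<le> vec.dim (eval_space p L)"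
      by (intro independent_card_le_dim_family[OF indep]) (use uW in \<open>auto simp: u'_def\<close>)
    then show False using dim by simp
  qed
  then show ?thesis using dim \<Xi>van linear_part_germ[OF hol_\<Xi>] by metis
qed

text \<open>
  The fields with value in the span of the values of \<open>G\<close> form a submodule that contains
  \<open>G\<close>.
\<close>

lemma eval_space_subset_span:
  assumes "G \<subseteq> L" "L = module_gen (germ_ring p) (der_module p) G"
  shows "eval_space p L \<subseteq> vec.span (germ_val p ` G)"
proof -
  define H where "H = {\<eta> \<in> carrier (der_module p). germ_val p \<eta> \<in> vec.span (germ_val p ` G)}"
  interpret module "germ_ring p" "der_module p" by (rule module_der)
  have "submodule H (germ_ring p) (der_module p)"
  proof (rule submoduleI)
    show "\<zero>\<^bsub>der_module p\<^esub> \<in> H"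
      by (simp add: H_def der_zero holomorphic_map_at_intros vec.span_zero)
    fix \<xi> assume "\<xi> \<in> H"
    then have \<xi>: "\<xi> \<in> carrier (der_module p)" "germ_val p \<xi> \<in> vec.span (germ_val p ` G)" by (auto simp: H_def)
    obtain F where F: "\<xi> = germ p F" "holomorphic_map_at F p" using \<xi>(1) by (rule der_moduleE)
    show "\<ominus>\<^bsub>der_module p\<^esub> \<xi> \<in> H"
      using \<xi>(2) F by (simp add: H_def der_uminus holomorphic_map_at_intros vec.span_neg)
    {
      fix \<eta> assume "\<eta> \<in> H"
      then have \<eta>: "\<eta> \<in> carrier (der_module p)" "germ_val p \<eta> \<in> vec.span (germ_val p ` G)" by (auto simp: H_def)
      obtain E where E: "\<eta> = germ p E" "holomorphic_map_at E p" using \<eta>(1) by (rule der_moduleE)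
      show "\<xi> \<oplus>\<^bsub>der_module p\<^esub> \<eta> \<in> H"
        using \<xi>(2) \<eta>(2) F E by (simp add: H_def holomorphic_map_at_intros vec.span_add)
    }
    fix a assume "a \<in> carrier (germ_ring p)"
    then obtain f where "a = germ p f" "holomorphic_at f p" by (rule germ_ringE)
    then show "a \<odot>\<^bsub>der_module p\<^esub> \<xi> \<in> H"
      using \<xi>(2) F by (simp add: H_def holomorphic_map_at_intros vec.span_scale)
  qed (auto simp: H_def)
  moreover have "G \<subseteq> H" using assms(1) L_carrier by (auto simp: H_def intro: vec.span_base)
  ultimately have "L \<subseteq> H" unfolding assms(2) module_gen_def by blast
  then show ?thesis by (auto simp: eval_space_def H_def)
qed

text \<open>
  The minors with all but one column fixed are linear over the ring of germs in the remaining
  column.  So, if all minors of generators were in \<open>M\<^sup>2\<close>, the last column could be any element of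
  \<open>L\<close>, in particular the field \<open>\<xi>\<close>, for which the derivative of the minor is nonzero.
\<close>

lemma minor_of_normal_direction:
  assumes G: "G \<subseteq> L" "L = module_gen (germ_ring p) (der_module p) G"
    and dim: "vec.dim (eval_space p L) = d"
    and \<xi>: "\<xi> \<in> vanishing_fields p L" and v: "linear_part p \<xi> v \<notin> eval_space p L"
  shows "\<exists>m\<in>minors p (Suc d) G. m \<notin> max_ideal p \<cdot>\<^bsub>germ_ring p\<^esub> max_ideal p"
proof (rule ccontr)
  assume "\<not> ?thesis"
  then have minors: "minors p (Suc d) G \<subseteq> max_ideal p \<cdot>\<^bsub>germ_ring p\<^esub> max_ideal p" by blast
  define y where "y = linear_part p \<xi> v"
  define M2 where "M2 = max_ideal p \<cdot>\<^bsub>germ_ring p\<^esub> max_ideal p"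
  interpret module "germ_ring p" "der_module p" by (rule module_der)
  interpret M2: ideal M2 "germ_ring p"
    using ideal_MI[of p "{p}"] by (simp add: M2_def MI_def max_ideal_eq_vanishing_ideal[symmetric])
  obtain B where B: "B \<subseteq> germ_val p ` G" "vec.independent B" "germ_val p ` G \<subseteq> vec.span B"
      "card B = vec.dim (germ_val p ` G)"
    by (rule vec.basis_exists)
  have GW: "germ_val p ` G \<subseteq> eval_space p L" using G(1) by (auto simp: eval_space_def)
  have spanB: "vec.span B \<subseteq> eval_space p L"
    using B(1) GW subspace_eval_space by (intro vec.span_minimal) auto
  have finB: "finite B" using B(2) by (rule vec.finiteI_independent)
  have "vec.dim (eval_space p L) \<le> vec.dim (germ_val p ` G)"
    using vec.dim_subset[OF eval_space_subset_span[OF G]] by simp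
  moreover have "vec.dim (germ_val p ` G) \<le> vec.dim (eval_space p L)"
    by (rule vec.dim_subset[OF GW])
  ultimately have cardB: "card B = d" using B(4) dim by simp
  obtain e where e: "bij_betw e {..<d} B"
    using ex_bij_betw_nat_finite[OF finB] unfolding cardB atLeast0LessThan by blast
  have "\<forall>j\<in>{..<d}. \<exists>\<eta>. \<eta> \<in> G \<and> germ_val p \<eta> = e j"
  proof
    fix j assume "j \<in> {..<d}"
    then have "e j \<in> germ_val p ` G" using e B(1) by (auto simp: bij_betw_def)
    then show "\<exists>\<eta>. \<eta> \<in> G \<and> germ_val p \<eta> = e j" by auto
  qed
  from bchoice[OF this] obtain c where "\<forall>j\<in>{..<d}. c j \<in> G \<and> germ_val p (c j) = e j" ..
  then have c: "\<And>j. j < d \<Longrightarrow> c j \<in> G" "\<And>j. j < d \<Longrightarrow> germ_val p (c j) = e j"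
    by auto
  \<comment> \<open>Values of \<open>d\<close> generators that form a basis of \<open>W\<close>, completed by a vector outside \<open>W\<close>.\<close>
  define u where "u j = (if j = d then y else e j)" for j
  have imu: "u ` {..<Suc d} = insert y B"
  proof -
    have "u ` {..<d} = e ` {..<d}" by (rule image_cong) (auto simp: u_def)
    also have "\<dots> = B" using e by (simp add: bij_betw_def)
    finally have "u ` {..<d} = B" .
    moreover have "u d = y" by (simp add: u_def)
    ultimately show ?thesis by (simp add: lessThan_Suc)
  qed
  have yB: "y \<notin> vec.span B" using v spanB by (auto simp: y_def)
  have inj_e: "inj_on e {..<d}" using e by (simp add: bij_betw_def)
  have e_ne: "e j \<noteq> y" if "j < d" for j
  proof -
    have "e j \<in> vec.span B" using bij_betwE[OF e] that by (intro vec.span_base) auto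
    then show ?thesis using yB by auto
  qed
  have "inj_on u {..<Suc d}"
  proof (rule inj_onI)
    fix i j assume ij: "i \<in> {..<Suc d}" "j \<in> {..<Suc d}" and eq: "u i = u j"
    show "i = j"
    proof (rule ccontr)
      assume ne: "i \<noteq> j"
      have "i < d \<or> i = d" "j < d \<or> j = d" using ij by auto
      with ne consider (both) "i < d" "j < d" | (left) "i = d" "j < d" | (right) "i < d" "j = d" by blast
      then show False
      proof cases
        case both
        then have "e i = e j" using eq by (simp add: u_def)
        with inj_onD[OF inj_e this] both ne show False by simp
      next
        case left
        with e_ne[OF left(2)] eq show False by (simp add: u_def)
      next
        case right
        with e_ne[OF right(1)] eq show False by (simp add: u_def)
      qed
    qed
  qed
  moreover have "vec.independent (insert y B)"
    using B(2) yB by (simp add: vec.independent_insertI)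
  ultimately have indep: "\<forall>x. (\<Sum>j<Suc d. x j *s u j) = 0 \<longrightarrow> (\<forall>j<Suc d. x j = 0)"
    by (subst independent_family_iff) (simp add: imu)
  obtain r where r: "nat_det (Suc d) (\<lambda>i j. u j $ r i) \<noteq> 0"
    using exists_nonzero_minor[where k = "Suc d" and u = u, OF indep[THEN spec, THEN mp]] by blast
  have inj_r: "inj_on r {..<Suc d}"
  proof (rule inj_onI, rule ccontr)
    fix i j assume "i \<in> {..<Suc d}" "j \<in> {..<Suc d}" "r i = r j" "i \<noteq> j"
    then have "nat_det (Suc d) (\<lambda>i j. u j $ r i) = 0"
      by (intro nat_det_eq_rows[of i _ j]) auto
    with r show False by simp
  qed
  have cc: "c j \<in> carrier (der_module p)" if "j < d" for j using c(1)[OF that] G(1) L_carrier by blast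
  \<comment> \<open>The minor of the chosen generators and a variable field in the last column.\<close>
  define \<Phi> where "\<Phi> E z = nat_det (Suc d) (\<lambda>i l. if l = d then E z $ r i else rep (c l) z $ r i)" for E z
  have hol_col: "holomorphic_at (\<lambda>z. if l = d then E z $ r i else rep (c l) z $ r i) p"
    if "l < Suc d" "holomorphic_map_at E p" for E i l
    using that der_rep(2)[OF cc, of l] by (cases "l = d") (auto simp: holomorphic_map_at_def)
  have hol_\<Phi>: "holomorphic_at (\<Phi> E) p" if "holomorphic_map_at E p" for E
    unfolding \<Phi>_def[abs_def] by (rule holomorphic_at_nat_det) (rule hol_col[OF _ that])
  define H where "H = {\<eta> \<in> carrier (der_module p). germ p (\<Phi> (rep \<eta>)) \<in> M2}"
  have H_iff: "germ p E \<in> H \<longleftrightarrow> holomorphic_map_at E p \<and> germ p (\<Phi> E) \<in> M2" for E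
  proof -
    have "germ p (\<Phi> (rep (germ p E))) = germ p (\<Phi> E)"
      by (rule germ_cong, use eventually_rep_germ[of p E] in eventually_elim) (simp add: \<Phi>_def cong: if_cong)
    then show ?thesis by (simp add: H_def)
  qed
  have \<Phi>_scale: "\<Phi> (\<lambda>z. f z *s E z) = (\<lambda>z. f z * \<Phi> E z)" for f E
    unfolding \<Phi>_def vector_smult_component by (intro ext nat_det_col_scale) simp
  have \<Phi>_add: "\<Phi> (\<lambda>z. E z + E' z) = (\<lambda>z. \<Phi> E z + \<Phi> E' z)" for E E'
    unfolding \<Phi>_def vector_add_component by (intro ext nat_det_col_add) simp
  have "submodule H (germ_ring p) (der_module p)"
  proof (rule submoduleI)
    have smult: "a \<odot>\<^bsub>der_module p\<^esub> \<eta> \<in> H" if a: "a \<in> carrier (germ_ring p)" and \<eta>: "\<eta> \<in> H" for a \<eta>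
    proof -
      obtain f where f: "a = germ p f" "holomorphic_at f p" using a by (rule germ_ringE)
      have "\<eta> \<in> carrier (der_module p)" using \<eta> by (simp add: H_def)
      then obtain E where E: "\<eta> = germ p E" "holomorphic_map_at E p" by (rule der_moduleE)
      then have "germ p f \<otimes>\<^bsub>germ_ring p\<^esub> germ p (\<Phi> E) \<in> M2"
        using \<eta> f by (intro M2.I_l_closed) (simp_all add: H_iff)
      then show ?thesis using f E by (simp add: H_iff \<Phi>_scale holomorphic_map_at_intros)
    qed
    then show "\<And>a \<eta>. a \<in> carrier (germ_ring p) \<Longrightarrow> \<eta> \<in> H \<Longrightarrow> a \<odot>\<^bsub>der_module p\<^esub> \<eta> \<in> H" .
    have "\<Phi> (\<lambda>_. 0) = (\<lambda>_. 0)" using \<Phi>_scale[of "\<lambda>_. 0" "\<lambda>_. 0"] by simp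
    then show "\<zero>\<^bsub>der_module p\<^esub> \<in> H"
      using M2.zero_closed by (simp add: der_zero H_iff holomorphic_map_at_intros germ_zero)
    fix \<eta> assume \<eta>: "\<eta> \<in> H"
    then have "\<eta> \<in> carrier (der_module p)" by (simp add: H_def)
    then obtain E where E: "\<eta> = germ p E" "holomorphic_map_at E p" by (rule der_moduleE)
    have "germ p (\<lambda>_. -1) \<odot>\<^bsub>der_module p\<^esub> \<eta> \<in> H" by (rule smult) (simp_all add: \<eta>)
    then show "\<ominus>\<^bsub>der_module p\<^esub> \<eta> \<in> H" using E by (simp add: der_uminus)
    fix \<eta>' assume \<eta>': "\<eta>' \<in> H"
    then have "\<eta>' \<in> carrier (der_module p)" by (simp add: H_def)
    then obtain E' where E': "\<eta>' = germ p E'" "holomorphic_map_at E' p" by (rule der_moduleE)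
    have "germ p (\<Phi> E) \<oplus>\<^bsub>germ_ring p\<^esub> germ p (\<Phi> E') \<in> M2"
      using \<eta> \<eta>' E E' by (intro M2.a_closed) (simp_all add: H_iff)
    then show "\<eta> \<oplus>\<^bsub>der_module p\<^esub> \<eta>' \<in> H"
      using E E' by (simp add: H_iff \<Phi>_add holomorphic_map_at_intros)
  qed (auto simp: H_def)
  moreover have "G \<subseteq> H"
  proof
    fix \<eta> assume \<eta>: "\<eta> \<in> G"
    then have \<eta>c: "\<eta> \<in> carrier (der_module p)" using G(1) L_carrier by blast
    define c' where "c' j = (if j = d then \<eta> else c j)" for j
    have c'G: "c' ` {..<Suc d} \<subseteq> G" using c(1) \<eta> by (auto simp: c'_def)
    have c'c: "c' j \<in> carrier (der_module p)" if "j < Suc d" for j using c'G that G(1) L_carrier by blast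
    have \<Phi>_c': "\<Phi> (rep \<eta>) = (\<lambda>z. nat_det (Suc d) (\<lambda>i j. rep (c' j) z $ r i))"
      unfolding \<Phi>_def[abs_def] by (intro ext nat_det_cong) (simp add: c'_def)
    have "germ p (\<Phi> (rep \<eta>)) \<in> M2"
    \<comment> \<open>A generator that is already among the columns gives determinant zero; otherwise the columns are distinct, as in the definition of a minor.\<close>
    proof (cases "\<eta> \<in> c ` {..<d}")
      case True
      then obtain j where j: "j < d" "\<eta> = c j" by auto
      have "\<Phi> (rep \<eta>) z = 0" for z
        unfolding \<Phi>_c' by (rule nat_det_eq_cols[of j _ d]) (use j in \<open>auto simp: c'_def\<close>)
      then have "\<Phi> (rep \<eta>) = (\<lambda>_. 0)" by auto
      then show ?thesis using M2.zero_closed by (simp add: germ_zero)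
    next
      case False
      have "inj_on c {..<d}"
      proof (rule inj_onI)
        fix i j assume "i \<in> {..<d}" "j \<in> {..<d}" "c i = c j"
        then show "i = j" using c(2)[of i] c(2)[of j] inj_e by (auto simp: inj_on_def)
      qed
      then have "inj_on c' {..<Suc d}"
        using False by (auto simp: inj_on_def c'_def less_Suc_eq)
      then have "ring_det (germ_ring p) (Suc d) (\<lambda>i j. coefficient p (c' j) (r i)) \<in> minors p (Suc d) G"
        unfolding minors_def using inj_r c'G by blast
      then show ?thesis
        using minors minor_germ(1)[of "Suc d" c' p r] c'c by (auto simp: \<Phi>_c' M2_def)
    qed
    then show "\<eta> \<in> H" using \<eta>c by (simp add: H_def)
  qed
  ultimately have "L \<subseteq> H" unfolding G(2) module_gen_def by blast
  moreover have \<xi>L: "\<xi> \<in> L" using \<xi> by (simp add: vanishing_fields_def)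
  ultimately have "germ p (\<Phi> (rep \<xi>)) \<in> M2" by (auto simp: H_def)
  then have grad0: "grad (\<Phi> (rep \<xi>)) p = 0" by (simp add: M2_def max_ideal_square_germ_iff)
  have \<xi>c: "\<xi> \<in> carrier (der_module p)" using \<xi>L L_carrier by blast
  have \<xi>0: "rep \<xi> p = 0" using \<xi> by (simp add: vanishing_fields_def germ_val_def)
  have "linform (grad (\<Phi> (rep \<xi>)) p) v =
      nat_det (Suc d) (\<lambda>i l. if l = d then linform (grad (\<lambda>z. if d = d then rep \<xi> z $ r i else rep (c d) z $ r i) p) v
        else if l = d then rep \<xi> p $ r i else rep (c l) p $ r i)"
    unfolding \<Phi>_def[abs_def]
    by (rule grad_nat_det_zero_col(2)) (simp_all add: \<xi>0 hol_col[OF _ der_rep(2)[OF \<xi>c]])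
  also have "\<dots> = nat_det (Suc d) (\<lambda>i j. u j $ r i)"
    by (rule nat_det_cong)
      (use c(2) in \<open>auto simp: u_def y_def der_rep(3)[OF \<xi>c] tangent_map_def germ_val_def less_Suc_eq\<close>)
  finally show False using r grad0 by (simp add: linform_def)
qed

end

section \<open>The equivalence\<close>

theorem proposition2p8:
  fixes X :: "(complex^'n) set" and p :: "complex^'n" and d :: nat
    and L G :: "('n, complex^'n) germ set"
  assumes smooth: "smooth_germ X p d"
    and dim: "d < CARD('n)"
    and submodule: "submodule L (germ_ring p) (der_module p)"
    and logarithmic: "L \<subseteq> der_log p X"
    and generators: "G \<subseteq> L" "L = module_gen (germ_ring p) (der_module p) G"
  defines "condition1 \<equiv>
      \<not> minor_ideal p (d + 1) G \<subseteq> max_ideal p \<cdot>\<^bsub>germ_ring p\<^esub> max_ideal p"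
    and "condition2 \<equiv> vec.dim (eval_space p L) = d \<and>
      (\<exists>\<xi> \<in> vanishing_fields p L. alpha p X \<xi> \<noteq> zero_conormal p X)"
    and "condition3 \<equiv> vec.dim (eval_space p L) = d \<and>
      (\<exists>\<xi> \<in> vanishing_fields p L. beta p L \<xi> \<noteq> zero_normal p L)"
  shows "(condition1 \<longleftrightarrow> condition2) \<and> (condition2 \<longleftrightarrow> condition3)"
proof -
  interpret logarithmic_submodule X p d L
    by (intro logarithmic_submodule.intro smooth submodule logarithmic)
  interpret R: cring "germ_ring p" by (rule cring_germ_ring)
  define M2 where "M2 = max_ideal p \<cdot>\<^bsub>germ_ring p\<^esub> max_ideal p"
  have ideal_M2: "ideal M2 (germ_ring p)"
    using ideal_MI[of p "{p}"] by (simp add: M2_def MI_def max_ideal_eq_vanishing_ideal[symmetric])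
  have minor: "m = germ p (\<lambda>z. nat_det (Suc d) (\<lambda>i j. rep (c j) z $ r i))"
      "m \<in> carrier (germ_ring p)"
    if "m = ring_det (germ_ring p) (Suc d) (\<lambda>i j. coefficient p (c j) (r i))" "c ` {..<Suc d} \<subseteq> G" for m c r
  proof -
    have "c j \<in> carrier (der_module p)" if "j < Suc d" for j
      using \<open>c ` {..<Suc d} \<subseteq> G\<close> that generators(1) L_carrier by blast
    then show "m = germ p (\<lambda>z. nat_det (Suc d) (\<lambda>i j. rep (c j) z $ r i))" "m \<in> carrier (germ_ring p)"
      using minor_germ[of "Suc d" c p r] that(1) by auto
  qed
  have "minors p (Suc d) G \<subseteq> carrier (germ_ring p)"
    unfolding minors_def using minor(2) by blast
  then have "minor_ideal p (d + 1) G \<subseteq> M2 \<longleftrightarrow> minors p (Suc d) G \<subseteq> M2"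
    unfolding minor_ideal_def
    using R.genideal_minimal[OF ideal_M2] R.genideal_self[of "minors p (Suc d) G"] by auto
  then have 1: "condition1 \<longleftrightarrow> (\<exists>m\<in>minors p (Suc d) G. m \<notin> M2)"
    unfolding condition1_def M2_def[symmetric] by blast
  have 3: "condition3 \<longleftrightarrow> vec.dim (eval_space p L) = d \<and>
      (\<exists>\<xi>\<in>vanishing_fields p L. \<exists>v. linear_part p \<xi> v \<notin> eval_space p L)"
    unfolding condition3_def using beta_nonzero_iff by blast
  have "condition1 \<longleftrightarrow> condition3"
  proof
    assume condition1
    then obtain m where m: "m \<in> minors p (Suc d) G" "m \<notin> M2" unfolding 1 by blast
    then obtain r c where rc: "m = ring_det (germ_ring p) (Suc d) (\<lambda>i j. coefficient p (c j) (r i))"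
        "c ` {..<Suc d} \<subseteq> G"
      unfolding minors_def by blast
    show condition3
      unfolding 3
    proof (rule normal_direction_of_minor)
      show "c j \<in> L" if "j < Suc d" for j using rc(2) generators(1) that by blast
      show "germ p (\<lambda>z. nat_det (Suc d) (\<lambda>i j. rep (c j) z $ r i)) \<notin> max_ideal p \<cdot>\<^bsub>germ_ring p\<^esub> max_ideal p"
        using m(2) minor(1)[OF rc] by (simp add: M2_def)
    qed
  next
    assume condition3
    then show condition1
      unfolding 1 3 M2_def using minor_of_normal_direction[OF generators] by blast
  qed
  moreover have "condition2 \<longleftrightarrow> condition3"
    unfolding condition2_def condition3_def using alpha_nonzero_iff_beta_nonzero by blast
  ultimately show ?thesis by blast
qed

end
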